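(* Let $\mathcal{H}$ be a real Hilbert space and let $f,g\colon\mathcal{H}\to\left]-\infty,+\infty\right]$ be proper convex lower semicontinuous functions with $\operatorname{dom} g\subset\operatorname{dom} f$. Suppose that $f$ is Gâteaux differentiable on $\operatorname{dom} g$ and that $\nabla f$ is $L$-Lipschitz continuous on $\operatorname{dom} g$ for some $L\in[0,+\infty[$. Let $(\langle\cdot\mid\cdot\rangle_k)_{k\in\mathbb{N}}$ be a sequence of scalar products on $\mathcal{H}$ with induced norms $\|\cdot\|_k$ and associated positive operators $W_k$, and suppose that there exist $0<\nu\le\mu$ such that $\nu\|\cdot\|^2\le\|\cdot\|_k^2\le\mu\|\cdot\|^2$ for every $k\in\mathbb{N}$. Set $\nu_k=\inf_{\|x\|=1}\langle x\mid W_kx\rangle$ and $\mu_k=\sup_{\|x\|=1}\langle x\mid W_kx\rangle$. Suppose that at least one of the following holds: - there exists a summable sequence $(\eta_k)_{k\in\mathbb{N}}$ in $[0,+\infty[$ such that $\|\cdot\|_{k+1}^2\le(1+\eta_k)\|\cdot\|_k^2$ for every $k\in\mathbb{N}$; - $\sum_{k\in\mathbb{N}}(\mu_k-\nu_k)<+\infty$. Let $(\gamma_k)_{k\in\mathbb{N}}$ in $\left]0,+\infty\right[$ and $(\lambda_k)_{k\in\mathbb{N}}$ in $\left]0,1\right]$ be chosen a priori so that $\inf_{k}\lambda_k>0$, $\inf_k\gamma_k>0$ and $\sup_{k}\gamma_k\lambda_k/\nu_k<2/L$. Let $x_0\in\operatorname{dom}g$ and, for every $k\in\mathbb{N}$,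 set $$y_k=\operatorname{prox}^k_{\gamma_kg}\big(x_k-\gamma_k\nabla^kf(x_k)\big),\qquad x_{k+1}=x_k+\lambda_k(y_k-x_k).$$ Set $S_*=\operatorname{argmin}_{\mathcal{H}}(f+g)$. Then the following hold. (i) $((f+g)(x_k))_{k\in\mathbb{N}}$ is decreasing. (ii) If $\inf_{k\in\mathbb{N}}(f+g)(x_k)>-\infty$, then $\sum_{k\in\mathbb{N}}\|x_{k+1}-x_k\|^2<+\infty$. (iii) Suppose that $S_*\ne\varnothing$. Then (a) $(x_k)_{k\in\mathbb{N}}$ and $(y_k)_{k\in\mathbb{N}}$ converge weakly to the same point in $S_*$; (b) $(f+g)(y_k)\to\inf_{\mathcal{H}}(f+g)$; (c) if $\sum_{k\in\mathbb{N}}\gamma_k\lambda_k=+\infty$, then $(f+g)(x_k)\to\inf_{\mathcal{H}}(f+g)$; (d) if $\inf_{k\in\mathbb{N}}\gamma_k\lambda_k>0$, then $(f+g)(x_k)-\inf_{\mathcal{H}}(f+g)=o(1/k)$. (iv) If $S_*=\varnothing$, then $\|x_k\|\to+\infty$ and $(f+g)(x_k)\to\inf_{\mathcal{H}}(f+g)$.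
   Context: $\mathcal{H}$ has scalar product $\langle\cdot\mid\cdot\rangle$ and norm $\|\cdot\|$. "Decreasing" means nonincreasing. If $L=0$, $2/L$ is read as $+\infty$. A proper convex function $h$ is Gâteaux differentiable at $x\in\operatorname{dom}h$ if there is $u\in\mathcal{H}$ with $\lim_{t\to0}(h(x+td)-h(x))/t=\langle d\mid u\rangle$ for all $d\in\mathcal{H}$; then $\nabla h(x):=u$. The positive operator $W_k\colon\mathcal{H}\to\mathcal{H}$ associated with $\langle\cdot\mid\cdot\rangle_k$ satisfies $\langle x\mid y\rangle_k=\langle x\mid W_ky\rangle$. $\nabla^kf$ is the gradient with respect to $\langle\cdot\mid\cdot\rangle_k$, i.e. $\nabla^kf(x)=W_k^{-1}\nabla f(x)$. For $h$ proper convex lower semicontinuous, $\operatorname{prox}^k_h(x)=\operatorname{argmin}_{y\in\mathcal{H}}\big(h(y)+\tfrac12\|y-x\|_k^2\big)$. *)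

theory Defs
  imports "HOL-Analysis.Analysis" "HOL-Library.Landau_Symbols"
begin

definition effective_domain :: "('a \<Rightarrow> ereal) \<Rightarrow> 'a set" where
  "effective_domain h = {x. h x < \<infinity>}"

definition proper_fun :: "('a \<Rightarrow> ereal) \<Rightarrow> bool" where
  "proper_fun h \<longleftrightarrow> (\<forall>x. h x \<noteq> -\<infinity>) \<and> effective_domain h \<noteq> {}"

text \<open>Only used for functions without the value \<open>-\<infinity>\<close>, so the right-hand side never
  involves \<open>\<infinity> - \<infinity>\<close>.\<close>
definition convex_fun :: "('a::real_vector \<Rightarrow> ereal) \<Rightarrow> bool" where
  "convex_fun h \<longleftrightarrow>
     (\<forall>x y t. 0 < t \<and> t < 1 \<longrightarrow>
        h ((1 - t) *\<^sub>R x + t *\<^sub>R y) \<le> ereal (1 - t) * h x + ereal t * h y)"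

definition lsc_fun :: "('a::topological_space \<Rightarrow> ereal) \<Rightarrow> bool" where
  "lsc_fun h \<longleftrightarrow> (\<forall>x. h x \<le> Liminf (at x) h)"

definition argmin_set :: "('a \<Rightarrow> ereal) \<Rightarrow> 'a set" where
  "argmin_set h = {x. is_arg_min h (\<lambda>_. True) x}"

definition is_scalar_product :: "('a::real_vector \<Rightarrow> 'a \<Rightarrow> real) \<Rightarrow> bool" where
  "is_scalar_product B \<longleftrightarrow>
     bilinear B \<and> (\<forall>x y. B x y = B y x) \<and> (\<forall>x. x \<noteq> 0 \<longrightarrow> 0 < B x x)"

definition induced_norm :: "('a \<Rightarrow> 'a \<Rightarrow> real) \<Rightarrow> 'a \<Rightarrow> real" where
  "induced_norm B x = sqrt (B x x)"

text \<open>Such a \<open>W\<close> is unique if it exists; for bounded \<open>B\<close> on a Hilbert space it exists by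
  Riesz representation.\<close>
definition associated_operator :: "('a::real_inner \<Rightarrow> 'a \<Rightarrow> real) \<Rightarrow> 'a \<Rightarrow> 'a" where
  "associated_operator B = (THE W. \<forall>x y. B x y = inner x (W y))"

text \<open>The limit is two-sided in \<open>t\<close>. Since it is required to be finite, \<open>h\<close> is finite
  on a neighbourhood of \<open>x\<close> in every line through \<open>x\<close>.\<close>
definition has_gateaux_gradient ::
  "('a::real_vector \<Rightarrow> 'a \<Rightarrow> real) \<Rightarrow> ('a \<Rightarrow> ereal) \<Rightarrow> 'a \<Rightarrow> 'a \<Rightarrow> bool" where
  "has_gateaux_gradient B h x u \<longleftrightarrow>
     x \<in> effective_domain h \<and>
     (\<forall>d. ((\<lambda>t. (h (x + t *\<^sub>R d) - h x) / ereal t) \<longlongrightarrow> ereal (B d u)) (at 0))"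

definition gateaux_differentiable :: "('a::real_inner \<Rightarrow> ereal) \<Rightarrow> 'a \<Rightarrow> bool" where
  "gateaux_differentiable h x \<longleftrightarrow> (\<exists>u. has_gateaux_gradient inner h x u)"

definition gateaux_gradient ::
  "('a::real_vector \<Rightarrow> 'a \<Rightarrow> real) \<Rightarrow> ('a \<Rightarrow> ereal) \<Rightarrow> 'a \<Rightarrow> 'a" where
  "gateaux_gradient B h x = (THE u. has_gateaux_gradient B h x u)"

definition prox ::
  "('a::real_vector \<Rightarrow> 'a \<Rightarrow> real) \<Rightarrow> ('a \<Rightarrow> ereal) \<Rightarrow> 'a \<Rightarrow> 'a" where
  "prox B h x = arg_min (\<lambda>y. h y + ereal (1 / 2 * (induced_norm B (y - x))\<^sup>2)) (\<lambda>_. True)"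

lemma has_gateaux_gradient_inner_unique:
  fixes h :: "'a::real_inner \<Rightarrow> ereal"
  assumes "has_gateaux_gradient inner h x u" "has_gateaux_gradient inner h x v"
  shows "u = v"
proof -
  have "inner d u = inner d v" for d
  proof -
    have "((\<lambda>t. (h (x + t *\<^sub>R d) - h x) / ereal t) \<longlongrightarrow> ereal (inner d u)) (at 0)"
      "((\<lambda>t. (h (x + t *\<^sub>R d) - h x) / ereal t) \<longlongrightarrow> ereal (inner d v)) (at 0)"
      using assms unfolding has_gateaux_gradient_def by blast+
    then have "ereal (inner d u) = ereal (inner d v)"
      by (intro tendsto_unique[of "at (0::real)"]) auto
    then show ?thesis by simp
  qed
  then have "inner (u - v) (u - v) = 0" by (simp add: inner_diff_right)
  then show ?thesis by simp
qed

lemma gateaux_gradient_eq_inv_operator: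
  fixes h :: "'a::real_inner \<Rightarrow> ereal"
  assumes "\<forall>x y. B x y = inner x (W y)" and "bij W" and "gateaux_differentiable h x"
  shows "gateaux_gradient B h x = inv W (gateaux_gradient inner h x)"
proof -
  obtain v where v: "has_gateaux_gradient inner h x v"
    using assms(3) unfolding gateaux_differentiable_def by blast
  have uniq: "has_gateaux_gradient inner h x u \<longleftrightarrow> u = v" for u
    using v has_gateaux_gradient_inner_unique by blast
  have "has_gateaux_gradient B h x u \<longleftrightarrow> has_gateaux_gradient inner h x (W u)" for u
    unfolding has_gateaux_gradient_def using assms(1) by simp
  then have "has_gateaux_gradient B h x u \<longleftrightarrow> u = inv W v" for u
    using uniq assms(2) by (metis bij_inv_eq_iff)
  then have "gateaux_gradient B h x = inv W v"
    unfolding gateaux_gradient_def by (intro the_equality) auto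
  moreover have "gateaux_gradient inner h x = v"
    unfolding gateaux_gradient_def using uniq by (intro the_equality) auto
  ultimately show ?thesis by simp
qed

definition weakly_converges :: "(nat \<Rightarrow> 'a::real_inner) \<Rightarrow> 'a \<Rightarrow> bool" where
  "weakly_converges u p \<longleftrightarrow> (\<forall>z. (\<lambda>k. inner (u k) z) \<longlonglongrightarrow> inner p z)"

end

theory Submission
  imports Defs
begin

text \<open>Dividing the metrics by suitable constants, bounded above and away from zero, and scaling
  the step sizes accordingly leaves the iteration unchanged; both hypotheses on the metrics reduce in
  this way to a decreasing sequence of metrics. The variational inequality that characterises
  \<open>y\<^sub>k\<close>, combined with the descent inequality for \<open>f\<close>, yields for every \<open>z\<close> in the domain of
  \<open>g\<close>
  \[\|x_{k+1}-z\|_{k+1}^2 \le \|x_k-z\|_k^2 + \varepsilon_k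
    - 2\gamma_k\lambda_k\,\bigl((f+g)(x_k)-(f+g)(z)\bigr),\]
  where the \<open>\<epsilon>\<^sub>k\<close> are summable as soon as \<open>(f + g)(x\<^sub>k)\<close> is bounded below. Hence, if
  \<open>(f + g)(z) \<le> (f + g)(x\<^sub>k)\<close> for all \<open>k\<close>, the differences \<open>(f + g)(x\<^sub>k) - (f + g)(z)\<close> are summable
  and decreasing, which gives convergence to the infimum and the rate, and \<open>x\<close> is Fejer monotone with
  respect to the minimisers, which gives weak convergence. If a subsequence of \<open>x\<close> is bounded, the
  sublevel sets meet a fixed ball in nonempty nested closed convex sets, whose intersection consists
  of minimisers.\<close>

section \<open>Semicontinuous convex functions\<close>

text \<open>The step condition bounds \<open>\<gamma> k * lam k\<close> and not
  \<open>\<gamma> k\<close> itself, so the descent is obtained at the relaxed point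
  \<open>x (Suc k)\<close>; the values at \<open>y k\<close> may exceed those at \<open>x k\<close>
  and are compared with them only afterwards. The remainder in the distance estimate therefore
  consists of a multiple of the squared length of \<open>y k - x k\<close> and a multiple of the
  telescoping decrease of the objective. Rescaling is possible because multiplying a metric and its
  step size by the same factor preserves the variational inequality, and the factor cancels in
  \<open>\<gamma> k * lam k / nu_seq k\<close>. Decreasing metrics pay off twice. Passing from
  metric \<open>k\<close> to metric \<open>Suc k\<close> costs nothing in the distance estimate.
  Moreover, differences of metrics are positive semidefinite, so Cauchy-Schwarz applies to them;
  this settles the uniqueness of weak cluster points, where the functional to be tested changes with
  \<open>k\<close>. Without a minimiser no lower bound for the values is at hand; arguing by
  contradiction supplies one.\<close>

lemma lsc_fun_iff:
  fixes h :: "'a::topological_space \<Rightarrow> ereal"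
  shows "lsc_fun h \<longleftrightarrow> (\<forall>x c. c < h x \<longrightarrow> (\<forall>\<^sub>F w in nhds x. c < h w))"
proof (intro iffI allI impI)
  fix x c assume "lsc_fun h" and c: "c < h x"
  then have "c < Liminf (at x) h"
    unfolding lsc_fun_def by (metis less_le_trans)
  then have "\<forall>\<^sub>F w in at x. c < h w"
    by (rule less_LiminfD)
  then show "\<forall>\<^sub>F w in nhds x. c < h w"
    unfolding eventually_at_filter by (rule eventually_mono) (use c in auto)
next
  assume *: "\<forall>x c. c < h x \<longrightarrow> (\<forall>\<^sub>F w in nhds x. c < h w)"
  show "lsc_fun h"
    unfolding lsc_fun_def le_Liminf_iff
    by (intro allI impI filter_leD[OF at_within_le_nhds] *[rule_format])
qed

lemma lsc_fun_add:
  fixes h k :: "'a::topological_space \<Rightarrow> ereal"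
  assumes h: "lsc_fun h" "\<And>x. h x \<noteq> -\<infinity>" and k: "lsc_fun k" "\<And>x. k x \<noteq> -\<infinity>"
  shows "lsc_fun (\<lambda>x. h x + k x)"
  unfolding lsc_fun_iff
proof (intro allI impI)
  fix x c assume c: "c < h x + k x"
  obtain r where r: "c < ereal r" "ereal r < h x + k x"
    using c ereal_dense2 by blast
  \<comment> \<open>The threshold \<open>r\<close> is split between the two summands. For finite
    values half of the gap is taken from each; if one value is infinite, its share is whatever the
    other one leaves over.\<close>
  obtain a b where ab: "ereal a < h x" "ereal b < k x" "r \<le> a + b"
  proof (cases "h x")
    case (real hx)
    show ?thesis
    proof (cases "k x")
      case (real kx)
      define e where "e = (hx + kx - r) / 2"
      have "0 < e" using r \<open>h x = ereal hx\<close> real by (simp add: e_def)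
      then show ?thesis
        using that[of "hx - e" "kx - e"] \<open>h x = ereal hx\<close> real by (simp add: e_def field_simps)
    next
      case PInf
      then show ?thesis using that[of "hx - 1" "r - hx + 1"] \<open>h x = ereal hx\<close> by simp
    qed (use k in auto)
  next
    case PInf
    obtain b where "ereal b < k x"
      using k(2)[of x] ereal_dense2[of "-\<infinity>" "k x"] by auto
    then show ?thesis using that[of "r - b" b] PInf by simp
  qed (use h in auto)
  have "\<forall>\<^sub>F w in nhds x. ereal a < h w" "\<forall>\<^sub>F w in nhds x. ereal b < k w"
    using h(1) k(1) ab unfolding lsc_fun_iff by blast+
  then show "\<forall>\<^sub>F w in nhds x. c < h w + k w"
  proof eventually_elim
    case (elim w)
    then have "ereal a + ereal b < h w + k w"
      by (rule ereal_add_strict_mono2)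
    moreover have "c < ereal a + ereal b"
      using r(1) ab(3) by (metis ereal_less_eq(3) less_le_trans plus_ereal.simps(1))
    ultimately show ?case by (rule less_trans[rotated])
  qed
qed

lemma lsc_fun_continuous:
  fixes r :: "'a::topological_space \<Rightarrow> real"
  assumes "continuous_on UNIV r"
  shows "lsc_fun (\<lambda>x. ereal (r x))"
  unfolding lsc_fun_iff
proof (intro allI impI)
  fix x c assume "c < ereal (r x)"
  moreover have "((\<lambda>w. ereal (r w)) \<longlongrightarrow> ereal (r x)) (nhds x)"
    using assms by (intro tendsto_ereal) (auto simp: continuous_on_def tendsto_at_iff_tendsto_nhds)
  ultimately show "\<forall>\<^sub>F w in nhds x. c < ereal (r w)"
    by (rule order_tendstoD(1)[rotated])
qed

lemma lsc_fun_closed_sublevel: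
  fixes h :: "'a::topological_space \<Rightarrow> ereal"
  assumes "lsc_fun h"
  shows "closed {x. h x \<le> c}"
proof -
  have "open {x. c < h x}"
  proof (subst open_subopen, intro ballI)
    fix x assume "x \<in> {x. c < h x}"
    then have "\<forall>\<^sub>F w in nhds x. c < h w"
      using assms by (simp add: lsc_fun_iff)
    then obtain U where "open U" "x \<in> U" "\<forall>w\<in>U. c < h w"
      by (auto simp: eventually_nhds)
    then show "\<exists>T. open T \<and> x \<in> T \<and> T \<subseteq> {x. c < h x}"
      by (intro exI[of _ U]) auto
  qed
  then show ?thesis by (simp add: closed_def Compl_eq not_le)
qed

lemma ereal_real_effective_domain:
  assumes "proper_fun h" "x \<in> effective_domain h"
  shows "h x = ereal (real_of_ereal (h x))"
  using assms by (cases "h x") (auto simp: proper_fun_def effective_domain_def)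

lemma convex_effective_domain:
  assumes "proper_fun h" "convex_fun h"
  shows "convex (effective_domain h)"
    and "convex_on (effective_domain h) (\<lambda>x. real_of_ereal (h x))"
proof -
  have main: "(1 - t) *\<^sub>R x + t *\<^sub>R y \<in> effective_domain h \<and>
      real_of_ereal (h ((1 - t) *\<^sub>R x + t *\<^sub>R y)) \<le> (1 - t) * real_of_ereal (h x) + t * real_of_ereal (h y)"
    if xy: "x \<in> effective_domain h" "y \<in> effective_domain h" and t: "0 < t" "t < 1" for x y t
  proof -
    obtain a b where ab: "h x = ereal a" "h y = ereal b"
      using ereal_real_effective_domain[OF assms(1)] xy by blast
    have "h ((1 - t) *\<^sub>R x + t *\<^sub>R y) \<le> ereal ((1 - t) * a + t * b)"
      using assms(2)[unfolded convex_fun_def, rule_format, of t x y] t by (simp add: ab)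
    then show ?thesis
      using assms(1) by (cases "h ((1 - t) *\<^sub>R x + t *\<^sub>R y)")
        (auto simp: ab effective_domain_def proper_fun_def)
  qed
  show "convex (effective_domain h)"
    unfolding convex_alt
  proof (intro ballI allI impI)
    fix x y and t :: real
    assume "x \<in> effective_domain h" "y \<in> effective_domain h" "0 \<le> t \<and> t \<le> 1"
    then show "(1 - t) *\<^sub>R x + t *\<^sub>R y \<in> effective_domain h"
      using main[of x y t] by (cases "t = 0 \<or> t = 1") auto
  qed
  then show "convex_on (effective_domain h) (\<lambda>x. real_of_ereal (h x))"
    by (intro convex_onI) (use main in auto)
qed

text \<open>A cone replaces the affine minorant of a Hahn-Banach argument. Semicontinuity gives
  \<open>h > c - 1\<close> on a ball around a point \<open>x0\<close> of the domain; for
  \<open>z\<close> outside, convexity on the segment from \<open>x0\<close> to \<open>z\<close>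
  transports this bound from the point at distance \<open>r\<close> from \<open>x0\<close>. Linear
  decay is all that a quadratic term has to beat in the proximal problem.\<close>

lemma convex_lsc_minorant:
  fixes h :: "'a::real_normed_vector \<Rightarrow> ereal"
  assumes "proper_fun h" "convex_fun h" "lsc_fun h"
  shows "\<exists>a b. 0 \<le> b \<and> (\<forall>z. ereal (a - b * norm z) \<le> h z)"
proof -
  obtain x0 where "x0 \<in> effective_domain h"
    using assms(1) by (auto simp: proper_fun_def)
  then obtain c where c: "h x0 = ereal c"
    using ereal_real_effective_domain[OF assms(1)] by blast
  have "\<forall>\<^sub>F w in nhds x0. ereal (c - 1) < h w"
    using assms(3) c unfolding lsc_fun_iff by simp
  then obtain e where e: "0 < e" "\<And>w. dist w x0 < e \<Longrightarrow> ereal (c - 1) < h w"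
    unfolding eventually_nhds_metric by auto
  define r where "r = e / 2"
  have r: "0 < r" "r < e" using e(1) by (auto simp: r_def)
  have low: "ereal (c - 1 - norm (z - x0) / r) \<le> h z" for z
  proof (cases "norm (z - x0) \<le> r")
    case True
    then have "ereal (c - 1) < h z" using e(2) r by (simp add: dist_norm)
    moreover have "c - 1 - norm (z - x0) / r \<le> c - 1" using r by simp
    ultimately show ?thesis by (meson ereal_less_eq(3) less_imp_le order_trans)
  next
    case False
    define t where "t = r / norm (z - x0)"
    have pos: "0 < norm (z - x0)" using False r by linarith
    have t: "0 < t" "t < 1" using False r pos by (auto simp: t_def field_simps)
    define w where "w = (1 - t) *\<^sub>R x0 + t *\<^sub>R z"
    have "w - x0 = t *\<^sub>R (z - x0)" by (simp add: w_def algebra_simps)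
    then have "dist w x0 = t * norm (z - x0)" using t by (simp add: dist_norm)
    then have "dist w x0 = r" using pos by (simp add: t_def)
    then have 1: "ereal (c - 1) < h w" using e(2) r by simp
    have 2: "h w \<le> ereal (1 - t) * h x0 + ereal t * h z"
      using assms(2) t unfolding convex_fun_def w_def by blast
    show ?thesis
    proof (cases "h z")
      case (real v)
      have "c - 1 < (1 - t) * c + t * v"
        using less_le_trans[OF 1 2] by (simp add: c real)
      then have "t * (c - v) < 1" by (simp add: algebra_simps)
      then have "c - v < 1 / t" using t by (simp add: field_simps)
      then have "c - v < norm (z - x0) / r" by (simp add: t_def)
      then show ?thesis by (simp add: real)
    qed (use assms(1) in \<open>auto simp: proper_fun_def\<close>)
  qed
  show ?thesis
  proof (rule exI[of _ "c - 1 - norm x0 / r"], rule exI[of _ "1 / r"], intro conjI allI)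
    fix z
    have "norm (z - x0) / r \<le> norm z / r + norm x0 / r"
      using norm_triangle_ineq4[of z x0] r by (simp add: field_simps)
    then have "ereal (c - 1 - norm x0 / r - 1 / r * norm z) \<le> ereal (c - 1 - norm (z - x0) / r)"
      by simp
    then show "ereal (c - 1 - norm x0 / r - 1 / r * norm z) \<le> h z"
      using low order_trans by blast
  qed (use r in simp)
qed

text \<open>Midpoints of near-minimisers cannot lie below the infimum, so \<open>mid\<close> forces
  the sublevel sets just above it to have small diameter, and completeness yields a common point.
  Stating \<open>mid\<close> through real levels \<open>r\<close> avoids arithmetic with infinite
  values.\<close>

lemma strongly_convex_has_minimizer:
  fixes \<psi> :: "'a::{real_normed_vector,complete_space} \<Rightarrow> ereal"
  assumes closed: "\<And>r. closed {z. \<psi> z \<le> ereal r}"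
    and finite: "\<psi> z0 < \<infinity>" and bdd: "\<And>z. ereal m0 \<le> \<psi> z" and \<kappa>: "0 < \<kappa>"
    and mid: "\<And>z w r. \<psi> z \<le> ereal r \<Longrightarrow> \<psi> w \<le> ereal r \<Longrightarrow>
      \<psi> ((1/2) *\<^sub>R z + (1/2) *\<^sub>R w) \<le> ereal (r - \<kappa> * (norm (z - w))\<^sup>2)"
  shows "\<exists>p. \<forall>z. \<psi> p \<le> \<psi> z"
proof -
  define I where "I = (INF z. \<psi> z)"
  have "ereal m0 \<le> I" unfolding I_def using bdd by (intro INF_greatest)
  moreover have "I \<le> \<psi> z0" unfolding I_def by (intro INF_lower) simp
  ultimately obtain m where m: "I = ereal m"
    using finite by (cases I) auto
  have low: "ereal m \<le> \<psi> z" for z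
    unfolding m[symmetric] I_def by (intro INF_lower) simp
  define S where "S = (\<lambda>n::nat. {z. \<psi> z \<le> ereal (m + 1 / Suc n)})"
  have "\<exists>p. \<forall>n. p \<in> S n"
  proof (rule decreasing_closed_nest[of S])
    show "closed (S n)" for n unfolding S_def by (rule closed)
    show "S n \<noteq> {}" for n
    proof -
      have "I < ereal (m + 1 / Suc n)" by (simp add: m)
      then obtain z where "\<psi> z < ereal (m + 1 / Suc n)"
        unfolding I_def by (auto simp: INF_less_iff)
      then show ?thesis unfolding S_def by (auto intro: less_imp_le)
    qed
    show "S n \<subseteq> S k" if "k \<le> n" for k n
    proof
      fix z assume "z \<in> S n"
      moreover have "1 / real (Suc n) \<le> 1 / real (Suc k)"
        using that by (intro divide_left_mono) auto
      ultimately show "z \<in> S k"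
        unfolding S_def using order_trans[of "\<psi> z" "ereal (m + 1 / Suc n)" "ereal (m + 1 / Suc k)"] by simp
    qed
    show "\<exists>n. \<forall>x\<in>S n. \<forall>y\<in>S n. dist x y < \<epsilon>" if "0 < \<epsilon>" for \<epsilon>
    proof -
      obtain n where n: "1 / real (Suc n) < \<kappa> * \<epsilon>\<^sup>2"
        using reals_Archimedean[of "\<kappa> * \<epsilon>\<^sup>2"] \<kappa> \<open>0 < \<epsilon>\<close>
        unfolding inverse_eq_divide by (meson mult_pos_pos zero_less_power)
      have "dist z w < \<epsilon>" if "z \<in> S n" "w \<in> S n" for z w
      proof -
        have "ereal m \<le> ereal (m + 1 / Suc n - \<kappa> * (norm (z - w))\<^sup>2)"
          using order_trans[OF low mid] that unfolding S_def by blast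
        then have "\<kappa> * (norm (z - w))\<^sup>2 < \<kappa> * \<epsilon>\<^sup>2"
          using n by simp
        then show ?thesis
          using \<kappa> \<open>0 < \<epsilon>\<close> by (simp add: dist_norm power_less_imp_less_base)
      qed
      then show ?thesis by blast
    qed
  qed blast
  then obtain p where p: "\<And>n. p \<in> S n"
    by blast
  have "\<psi> p \<le> ereal m"
  proof (rule ereal_le_epsilon2)
      fix e :: real assume "0 < e"
      then obtain n where "1 / real (Suc n) < e"
        using reals_Archimedean[of e] unfolding inverse_eq_divide by blast
      moreover have "\<psi> p \<le> ereal (m + 1 / Suc n)" using p[of n] by (simp add: S_def)
      ultimately show "\<psi> p \<le> ereal m + ereal e"
        using order_trans[of "\<psi> p" "ereal (m + 1 / Suc n)" "ereal (m + e)"] by simp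
  qed
  then show ?thesis by (meson low order_trans)
qed

section \<open>Scalar products\<close>

text \<open>Semidefiniteness is the right generality because the form will also be a difference of
  two metrics; hence the separate case of a vector with \<open>E y y = 0\<close>.\<close>

lemma psd_cauchy_schwarz:
  fixes E :: "'a::real_vector \<Rightarrow> 'a \<Rightarrow> real"
  assumes "bilinear E" "\<And>x y. E x y = E y x" and nonneg: "\<And>x. 0 \<le> E x x"
  shows "(E x y)\<^sup>2 \<le> E x x * E y y"
proof -
  have quad: "0 \<le> E x x + 2 * t * E x y + t\<^sup>2 * E y y" for t
  proof -
    have "E (x + t *\<^sub>R y) (x + t *\<^sub>R y) = E x x + 2 * t * E x y + t\<^sup>2 * E y y"
      using assms(2)[of y x]
      by (simp add: bilinear_ladd[OF assms(1)] bilinear_radd[OF assms(1)]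
          bilinear_lmul[OF assms(1)] bilinear_rmul[OF assms(1)] power2_eq_square algebra_simps)
    then show ?thesis using nonneg[of "x + t *\<^sub>R y"] by simp
  qed
  show ?thesis
  proof (cases "E y y = 0")
    case True
    have "E x y = 0"
    proof (rule ccontr)
      assume ne: "E x y \<noteq> 0"
      \<comment> \<open>For \<open>E y y = 0\<close> the quadratic is affine in its parameter; this
        choice of the parameter gives it the value -1.\<close>
      show False
        using quad[of "- (E x x + 1) / (2 * E x y)"] ne True by (simp add: field_simps)
    qed
    then show ?thesis by (simp add: True)
  next
    case False
    then have pos: "0 < E y y" using nonneg[of y] by simp
    have "0 \<le> E x x - (E x y)\<^sup>2 / E y y"
      using quad[of "- E x y / E y y"] pos by (simp add: field_simps power2_eq_square)
    then show ?thesis using pos by (simp add: field_simps)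
  qed
qed

lemma scalar_product_nonneg: "is_scalar_product B \<Longrightarrow> 0 \<le> B x x"
  by (cases "x = 0") (auto simp: is_scalar_product_def bilinear_lzero intro: less_imp_le)

lemma induced_norm_square: "is_scalar_product B \<Longrightarrow> (induced_norm B x)\<^sup>2 = B x x"
  by (simp add: induced_norm_def scalar_product_nonneg)

lemma scalar_product_scale:
  assumes "is_scalar_product B" "0 < s"
  shows "is_scalar_product (\<lambda>x y. s * B x y)"
proof -
  have bil: "bilinear B" using assms(1) by (simp add: is_scalar_product_def)
  have "bilinear (\<lambda>x y. s * B x y)"
    unfolding bilinear_def linear_iff
    by (simp add: bilinear_ladd[OF bil] bilinear_radd[OF bil] bilinear_lmul[OF bil]
        bilinear_rmul[OF bil] distrib_left)
  then show ?thesis using assms by (simp add: is_scalar_product_def)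
qed

lemma scalar_product_bounded_bilinear:
  fixes B :: "'a::real_normed_vector \<Rightarrow> 'a \<Rightarrow> real"
  assumes sp: "is_scalar_product B" and up: "\<And>x. B x x \<le> \<mu> * (norm x)\<^sup>2"
  shows "bounded_bilinear B"
proof -
  have bil: "bilinear B" and sym: "\<And>x y. B x y = B y x"
    using sp by (auto simp: is_scalar_product_def)
  have "norm (B x y) \<le> norm x * norm y * \<bar>\<mu>\<bar>" for x y
  proof -
    have up': "B z z \<le> \<bar>\<mu>\<bar> * (norm z)\<^sup>2" for z
      using up[of z] by (meson abs_ge_self mult_right_mono order_trans zero_le_power2)
    have "(B x y)\<^sup>2 \<le> B x x * B y y"
      using psd_cauchy_schwarz[OF bil sym scalar_product_nonneg[OF sp]] .
    also have "\<dots> \<le> (\<bar>\<mu>\<bar> * (norm x)\<^sup>2) * (\<bar>\<mu>\<bar> * (norm y)\<^sup>2)"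
      by (intro mult_mono up' scalar_product_nonneg[OF sp]) auto
    also have "\<dots> = (norm x * norm y * \<bar>\<mu>\<bar>)\<^sup>2" by (simp add: power2_eq_square)
    finally have "\<bar>B x y\<bar> \<le> \<bar>norm x * norm y * \<bar>\<mu>\<bar>\<bar>"
      by (simp only: abs_le_square_iff)
    then show ?thesis by (simp add: abs_mult)
  qed
  then show ?thesis
    by unfold_locales
      (simp_all add: bilinear_ladd[OF bil] bilinear_radd[OF bil] bilinear_lmul[OF bil] bilinear_rmul[OF bil],
        blast)
qed

section \<open>The proximity operator\<close>

lemma prox_exists:
  fixes h :: "'a::{real_inner,complete_space} \<Rightarrow> ereal"
  assumes sp: "is_scalar_product B"
    and bounds: "0 < \<nu>" "\<And>x. \<nu> * (norm x)\<^sup>2 \<le> B x x" "\<And>x. B x x \<le> \<mu> * (norm x)\<^sup>2"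
    and h: "proper_fun h" "convex_fun h" "lsc_fun h"
  shows "\<exists>p. \<forall>z. h p + ereal (1 / 2 * (induced_norm B (p - u))\<^sup>2)
    \<le> h z + ereal (1 / 2 * (induced_norm B (z - u))\<^sup>2)"
proof -
  interpret B: bounded_bilinear B
    by (rule scalar_product_bounded_bilinear[OF sp bounds(3)])
  have sym: "B x y = B y x" for x y using sp by (auto simp: is_scalar_product_def)
  define \<psi> where "\<psi> = (\<lambda>z. h z + ereal (1 / 2 * B (z - u) (z - u)))"
  obtain a b where ab: "0 \<le> b" "\<forall>z. ereal (a - b * norm z) \<le> h z"
    using convex_lsc_minorant[OF h] by blast
  obtain z0 where z0: "z0 \<in> effective_domain h" using h(1) by (auto simp: proper_fun_def)
  have "\<exists>p. \<forall>z. \<psi> p \<le> \<psi> z"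
  proof (rule strongly_convex_has_minimizer)
    have "continuous_on UNIV (\<lambda>z. 1 / 2 * B (z - u) (z - u))"
      by (intro continuous_intros B.continuous_on)
    then have "lsc_fun \<psi>"
      unfolding \<psi>_def using h
      by (intro lsc_fun_add lsc_fun_continuous) (auto simp: proper_fun_def)
    then show "closed {z. \<psi> z \<le> ereal r}" for r
      by (rule lsc_fun_closed_sublevel)
    show "\<psi> z0 < \<infinity>" using z0 by (simp add: \<psi>_def effective_domain_def)
    \<comment> \<open>With \<open>r = norm (z - u)\<close>, completing the square shows that
      \<open>\<nu> * r\<^sup>2 / 2 - b * r\<close> is at least
      \<open>- b\<^sup>2 / (2 * \<nu>)\<close>.\<close>
    show "ereal (a - b * norm u - b\<^sup>2 / (2 * \<nu>)) \<le> \<psi> z" for z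
    proof -
      define r where "r = norm (z - u)"
      have "norm z \<le> norm u + r" unfolding r_def by (metis add.commute norm_triangle_sub)
      then have 1: "b * norm z \<le> b * norm u + b * r"
        using ab(1) by (metis distrib_left mult_left_mono)
      have "0 \<le> (\<nu> * r - b)\<^sup>2 / (2 * \<nu>)" using bounds(1) by simp
      also have "\<dots> = \<nu> * r\<^sup>2 / 2 - b * r + b\<^sup>2 / (2 * \<nu>)"
        using bounds(1) by (simp add: field_simps power2_eq_square)
      finally have "a - b * norm u - b\<^sup>2 / (2 * \<nu>) \<le> (a - b * norm z) + 1 / 2 * B (z - u) (z - u)"
        using 1 bounds(2)[of "z - u"] unfolding r_def[symmetric] by linarith
      then have "ereal (a - b * norm u - b\<^sup>2 / (2 * \<nu>)) \<le> ereal (a - b * norm z) + ereal (1 / 2 * B (z - u) (z - u))"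
        by simp
      also have "\<dots> \<le> \<psi> z" unfolding \<psi>_def by (intro add_right_mono ab(2)[rule_format])
      finally show ?thesis .
    qed
    \<comment> \<open>The parallelogram law contributes a quarter of
      \<open>B (z - w) (z - w)\<close>, and the factor 1/2 in the proximal objective halves
      it.\<close>
    show "0 < \<nu> / 8" using bounds by simp
    show "\<psi> ((1/2) *\<^sub>R z + (1/2) *\<^sub>R w) \<le> ereal (r - \<nu> / 8 * (norm (z - w))\<^sup>2)"
      if le: "\<psi> z \<le> ereal r" "\<psi> w \<le> ereal r" for z w r
    proof -
      have "z \<in> effective_domain h" "w \<in> effective_domain h"
        using le by (auto simp: \<psi>_def effective_domain_def)
      then obtain s t where st: "h z = ereal s" "h w = ereal t"
        using ereal_real_effective_domain[OF h(1)] by blast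
      have "h ((1 - 1/2) *\<^sub>R z + (1/2) *\<^sub>R w) \<le> ereal (1 - 1/2) * h z + ereal (1/2) * h w"
        by (rule h(2)[unfolded convex_fun_def, rule_format]) simp
      then have hm: "h ((1/2) *\<^sub>R z + (1/2) *\<^sub>R w) \<le> ereal ((s + t) / 2)"
        by (simp add: st add_divide_distrib)
      define m where "m = (1/2) *\<^sub>R z + (1/2) *\<^sub>R w - u"
      have m: "m = (1/2) *\<^sub>R ((z - u) + (w - u))"
        proof -
        have "(1/2) *\<^sub>R u + (1/2) *\<^sub>R u = u" by (simp flip: scaleR_left_distrib)
        then show ?thesis
          unfolding m_def
          by (simp only: scaleR_right_distrib scaleR_right_diff_distrib add_diff_add[symmetric])
      qed
      have "B ((1/2) *\<^sub>R (a + b)) ((1/2) *\<^sub>R (a + b)) = B a a / 2 + B b b / 2 - B (a - b) (a - b) / 4" for a b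
        using sym[of b a]
        by (simp add: B.add_left B.add_right B.scaleR_left B.scaleR_right B.diff_left B.diff_right field_simps)
      from this[of "z - u" "w - u"]
      have "B m m = B (z - u) (z - u) / 2 + B (w - u) (w - u) / 2 - B (z - w) (z - w) / 4"
        unfolding m by simp
      moreover have "s + B (z - u) (z - u) / 2 \<le> r" "t + B (w - u) (w - u) / 2 \<le> r"
        using le by (simp_all add: \<psi>_def st)
      moreover have "\<nu> / 8 * (norm (z - w))\<^sup>2 \<le> B (z - w) (z - w) / 8"
        using bounds(2)[of "z - w"] by simp
      ultimately have le': "(s + t) / 2 + B m m / 2 \<le> r - \<nu> / 8 * (norm (z - w))\<^sup>2"
        by (simp only: diff_divide_distrib add_divide_distrib)
      have "\<psi> ((1/2) *\<^sub>R z + (1/2) *\<^sub>R w) \<le> ereal ((s + t) / 2) + ereal (1 / 2 * B m m)"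
        unfolding \<psi>_def m_def by (rule add_right_mono[OF hm])
      also have "\<dots> \<le> ereal (r - \<nu> / 8 * (norm (z - w))\<^sup>2)"
        using le' by simp
      finally show ?thesis .
    qed
  qed
  then show ?thesis
    by (simp only: \<psi>_def induced_norm_square[OF sp])
qed

lemma nonneg_if_nonneg_near_zero:
  fixes a b :: real
  assumes "\<And>t. 0 < t \<Longrightarrow> t < 1 \<Longrightarrow> 0 \<le> a + t * b"
  shows "0 \<le> a"
proof (rule tendsto_lowerbound)
  show "((\<lambda>t. a + t * b) \<longlongrightarrow> a) (at_right 0)"
    by (auto intro!: tendsto_eq_intros)
  show "\<forall>\<^sub>F t in at_right 0. 0 \<le> a + t * b"
    by (rule eventually_mono[OF eventually_at_right_real[of 0 1]]) (use assms in auto)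
qed simp

text \<open>The minimiser \<open>p\<close> is compared with the points
  \<open>p + t *\<^sub>R (z - p)\<close>. Convexity makes the difference of the values
  \<open>t\<close> times an affine function of \<open>t\<close>; dividing by \<open>t\<close> and
  letting it tend to 0 leaves the inequality.\<close>

lemma prox_variational_inequality:
  fixes h :: "'a::real_inner \<Rightarrow> ereal"
  assumes sp: "is_scalar_product B" and h: "proper_fun h" "convex_fun h"
    and min: "\<And>z. h p + ereal (1 / 2 * (induced_norm B (p - u))\<^sup>2)
      \<le> h z + ereal (1 / 2 * (induced_norm B (z - u))\<^sup>2)"
  shows "p \<in> effective_domain h"
    and "z \<in> effective_domain h \<Longrightarrow> B (z - p) (u - p) \<le> real_of_ereal (h z) - real_of_ereal (h p)"
proof -
  obtain z0 where z0: "z0 \<in> effective_domain h" using h(1) by (auto simp: proper_fun_def)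
  have "h p + ereal (1 / 2 * (induced_norm B (p - u))\<^sup>2) < \<infinity>"
    by (rule le_less_trans[OF min[of z0]]) (use z0 in \<open>simp add: effective_domain_def\<close>)
  then show p: "p \<in> effective_domain h" by (simp add: effective_domain_def)
  assume z: "z \<in> effective_domain h"
  obtain r s where rs: "h p = ereal r" "h z = ereal s"
    using ereal_real_effective_domain[OF h(1)] p z by blast
  have bil: "bilinear B" and sym: "\<And>x y. B x y = B y x"
    using sp by (auto simp: is_scalar_product_def)
  have "0 \<le> (s - r - B (z - p) (u - p)) + t * (B (z - p) (z - p) / 2)" if t: "0 < t" "t < 1" for t
  proof -
    define w where "w = (1 - t) *\<^sub>R p + t *\<^sub>R z"
    have "w - u = (p - u) + t *\<^sub>R (z - p)" by (simp add: w_def algebra_simps)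
    then have Bw: "B (w - u) (w - u) = B (p - u) (p - u) + 2 * t * B (z - p) (p - u) + t * t * B (z - p) (z - p)"
      using sym[of "p - u" "z - p"]
      by (simp only: bilinear_ladd[OF bil] bilinear_radd[OF bil] bilinear_lmul[OF bil] bilinear_rmul[OF bil])
        (simp add: algebra_simps)
    have "h w \<le> ereal (1 - t) * h p + ereal t * h z"
      using h(2) t unfolding convex_fun_def w_def by blast
    then have "h w \<le> ereal ((1 - t) * r + t * s)" by (simp add: rs)
    then have "h w + ereal (1 / 2 * B (w - u) (w - u)) \<le> ereal ((1 - t) * r + t * s) + ereal (1 / 2 * B (w - u) (w - u))"
      by (intro add_right_mono)
    from order_trans[OF min[of w, unfolded induced_norm_square[OF sp]] this]
    have "ereal (r + 1 / 2 * B (p - u) (p - u)) \<le> ereal ((1 - t) * r + t * s + 1 / 2 * B (w - u) (w - u))"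
      by (simp add: rs)
    then have "0 \<le> t * ((s - r + B (z - p) (p - u)) + t * (B (z - p) (z - p) / 2))"
      by (simp add: Bw algebra_simps)
    then have "0 \<le> (s - r + B (z - p) (p - u)) + t * (B (z - p) (z - p) / 2)"
      using t by (simp add: zero_le_mult_iff)
    moreover have "B (z - p) (p - u) = - B (z - p) (u - p)"
      using bilinear_rneg[OF bil, of "z - p" "u - p"] by simp
    ultimately show ?thesis by simp
  qed
  then have "0 \<le> s - r - B (z - p) (u - p)"
    by (rule nonneg_if_nonneg_near_zero)
  then show "B (z - p) (u - p) \<le> real_of_ereal (h z) - real_of_ereal (h p)"
    by (simp add: rs)
qed

text \<open>The Riesz vector is the proximal point of a linear functional.\<close>

lemma scalar_product_riesz:
  fixes \<phi> :: "'a::{real_inner,complete_space} \<Rightarrow> real"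
  assumes sp: "is_scalar_product B"
    and bounds: "0 < \<nu>" "\<And>x. \<nu> * (norm x)\<^sup>2 \<le> B x x" "\<And>x. B x x \<le> \<mu> * (norm x)\<^sup>2"
    and lin: "bounded_linear \<phi>"
  shows "\<exists>u. \<forall>d. B d u = \<phi> d"
proof -
  interpret \<phi>: bounded_linear \<phi> by fact
  define h where "h = (\<lambda>z. ereal (- \<phi> z))"
  have dom: "effective_domain h = UNIV" by (simp add: effective_domain_def h_def)
  then have h: "proper_fun h" "convex_fun h" "lsc_fun h"
    unfolding h_def
    by (simp_all add: proper_fun_def convex_fun_def \<phi>.add \<phi>.scaleR
        lsc_fun_continuous continuous_on_minus \<phi>.continuous_on)
  obtain p where min: "\<And>z. h p + ereal (1 / 2 * (induced_norm B (p - 0))\<^sup>2)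
      \<le> h z + ereal (1 / 2 * (induced_norm B (z - 0))\<^sup>2)"
    using prox_exists[OF sp bounds h, of 0] by blast
  have bil: "bilinear B" using sp by (auto simp: is_scalar_product_def)
  have le: "\<phi> d \<le> B d p" for d
    using prox_variational_inequality(2)[OF sp h(1,2) min, of "p + d"]
    unfolding dom by (simp add: h_def \<phi>.add bilinear_rneg[OF bil])
  have "B d p = \<phi> d" for d
    using le[of d] le[of "- d"] by (simp add: \<phi>.neg bilinear_lneg[OF bil])
  then show ?thesis by blast
qed

section \<open>Weak convergence\<close>

text \<open>Each set is cut down to its nearly shortest elements, measured against the supremum
  \<open>M\<close> of the squared distances from the origin. By the parallelogram law, applied with
  midpoints in the convex set, the cut sets have diameters tending to 0, so completeness
  suffices.\<close>

lemma nested_closed_convex_nonempty: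
  fixes C :: "nat \<Rightarrow> 'a::{real_inner,complete_space} set"
  assumes closed: "\<And>n. closed (C n)" and convex: "\<And>n. convex (C n)"
    and ne: "\<And>n. C n \<noteq> {}" and dec: "\<And>m n. m \<le> n \<Longrightarrow> C n \<subseteq> C m"
    and bdd: "bounded (C 0)"
  shows "\<exists>q. \<forall>n. q \<in> C n"
proof -
  obtain R where R: "\<And>z. z \<in> C 0 \<Longrightarrow> norm z \<le> R"
    using bdd unfolding bounded_iff by blast
  have R2: "(norm z)\<^sup>2 \<le> R\<^sup>2" if "z \<in> C n" for z n
    using R[of z] dec[of 0 n] that by (intro power_mono) auto
  define d where "d = (\<lambda>n. INF z\<in>C n. (norm z)\<^sup>2)"
  have bb: "bdd_below ((\<lambda>z. (norm z)\<^sup>2) ` C n)" for n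
    by (intro bdd_belowI2[of _ 0]) auto
  have d_le: "d n \<le> (norm z)\<^sup>2" if "z \<in> C n" for z n
    unfolding d_def using bb that by (rule cINF_lower)
  have d_mono: "d m \<le> d n" if "m \<le> n" for m n
    unfolding d_def using ne bb dec[OF that] by (intro cINF_superset_mono) auto
  define M where "M = (SUP n. d n)"
  have d_bdd: "bdd_above (range d)"
  proof (rule bdd_aboveI2)
    fix n
    obtain z where "z \<in> C n" using ne by blast
    then show "d n \<le> R\<^sup>2" using d_le R2 order_trans by blast
  qed
  have d_M: "d n \<le> M" for n
    unfolding M_def by (intro cSUP_upper d_bdd) simp
  define D where "D = (\<lambda>n. {z \<in> C n. (norm z)\<^sup>2 \<le> M + 1 / Suc n})"
  have "\<exists>q. \<forall>n. q \<in> D n"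
  proof (rule decreasing_closed_nest[of D])
    show "closed (D n)" for n
    proof -
      have "closed {z::'a. (norm z)\<^sup>2 \<le> M + 1 / Suc n}"
        by (intro closed_Collect_le continuous_intros)
      then have "closed (C n \<inter> {z. (norm z)\<^sup>2 \<le> M + 1 / Suc n})"
        using closed by blast
      moreover have "C n \<inter> {z. (norm z)\<^sup>2 \<le> M + 1 / Suc n} = D n"
        by (auto simp: D_def)
      ultimately show ?thesis by simp
    qed
    show "D n \<noteq> {}" for n
    proof -
      have "d n < M + 1 / Suc n" using d_M[of n] by (simp add: add_strict_increasing2 le_less_trans)
      then obtain z where "z \<in> C n" "(norm z)\<^sup>2 < M + 1 / Suc n"
        unfolding d_def using ne bb by (auto simp: cINF_less_iff)
      then show ?thesis unfolding D_def by (auto intro: less_imp_le)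
    qed
    show "D n \<subseteq> D m" if "m \<le> n" for m n
    proof -
      have "1 / real (Suc n) \<le> 1 / real (Suc m)"
        using that by (intro divide_left_mono) auto
      then show ?thesis using dec[OF that] unfolding D_def by force
    qed
    show "\<exists>n. \<forall>z\<in>D n. \<forall>w\<in>D n. dist z w < e" if "0 < e" for e
    proof -
      \<comment> \<open>Norms exceed \<open>M\<close> by less than \<open>e'\<close> after squaring,
        and the midpoint falls below \<open>M\<close> by less than \<open>e'\<close>; the
        parallelogram law weights both errors by 4, giving \<open>8 * e'\<close> in total.\<close>
      define e' where "e' = e\<^sup>2 / 8"
      have e': "0 < e'" using that by (simp add: e'_def)
      obtain n1 where n1: "M - e' < d n1"
        using less_cSUP_iff[OF _ d_bdd, of "M - e'"] e' unfolding M_def[symmetric] by auto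
      obtain n2 where n2: "1 / real (Suc n2) < e'"
        using reals_Archimedean[OF e'] unfolding inverse_eq_divide by blast
      define n where "n = max n1 n2"
      have n: "M - e' < d n" using n1 d_mono[of n1 n] by (simp add: n_def)
      have n': "1 / real (Suc n) < e'"
        by (rule le_less_trans[OF _ n2], intro divide_left_mono) (auto simp: n_def)
      have "dist z w < e" if zw: "z \<in> D n" "w \<in> D n" for z w
      proof -
        have "(1/2) *\<^sub>R z + (1/2) *\<^sub>R w \<in> C n"
          using zw by (intro convexD[OF convex]) (auto simp: D_def)
        then have 1: "d n \<le> (norm ((1/2) *\<^sub>R z + (1/2) *\<^sub>R w))\<^sup>2" by (rule d_le)
        have 2: "(norm (z - w))\<^sup>2 = 2 * (norm z)\<^sup>2 + 2 * (norm w)\<^sup>2 - 4 * (norm ((1/2) *\<^sub>R z + (1/2) *\<^sub>R w))\<^sup>2"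
          unfolding power2_norm_eq_inner
          by (simp add: inner_add_left inner_add_right inner_diff_left inner_diff_right inner_commute)
        have 3: "(norm z)\<^sup>2 \<le> M + 1 / Suc n" "(norm w)\<^sup>2 \<le> M + 1 / Suc n"
          using zw by (auto simp: D_def)
        have "(norm (z - w))\<^sup>2 < e\<^sup>2"
          using 1 2 3 n n' unfolding e'_def by linarith
        then show ?thesis using \<open>0 < e\<close> by (simp add: dist_norm power_less_imp_less_base)
      qed
      then show ?thesis by blast
    qed
  qed blast
  then show ?thesis by (auto simp: D_def)
qed

lemma closure_convex_hull_subset:
  assumes "S \<subseteq> T" "closed T" "convex T"
  shows "closure (convex hull S) \<subseteq> T"
  using assms by (intro closure_minimal hull_minimal)

text \<open>Instead of weak compactness of balls, cluster points are taken in the intersection of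
  the closed convex hulls of the tails.\<close>

lemma tail_hulls_nonempty:
  fixes x :: "nat \<Rightarrow> 'a::{real_inner,complete_space}"
  assumes "bounded (range x)" "infinite K"
  shows "\<exists>q. \<forall>n. q \<in> closure (convex hull (x ` (K \<inter> {n..})))"
proof (rule nested_closed_convex_nonempty)
  fix n
  obtain k where "k \<in> K" "n \<le> k"
    using assms(2) by (meson infinite_nat_iff_unbounded_le)
  then have "x k \<in> convex hull (x ` (K \<inter> {n..}))"
    by (intro hull_inc) auto
  then show "closure (convex hull (x ` (K \<inter> {n..}))) \<noteq> {}"
    using closure_subset by blast
next
  show "bounded (closure (convex hull (x ` (K \<inter> {0..}))))"
    using assms(1) by (intro bounded_closure bounded_convex_hull) (rule bounded_subset, auto)
next
  fix m n :: nat
  assume "m \<le> n"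
  then show "closure (convex hull (x ` (K \<inter> {n..}))) \<subseteq> closure (convex hull (x ` (K \<inter> {m..})))"
    by (intro closure_mono hull_mono image_mono) auto
qed (auto intro: convex_closure)

text \<open>If \<open>inner (x k) z\<close> exceeded \<open>inner p z + e\<close> for infinitely
  many \<open>k\<close>, these indices alone would have a cluster point in the corresponding closed
  half-space. It is also a cluster point of the whole sequence, hence equal to \<open>p\<close>,
  which lies outside that half-space. Replacing \<open>z\<close> by \<open>- z\<close> gives the
  bound from the other side.\<close>

lemma weakly_converges_if_unique_cluster:
  fixes x :: "nat \<Rightarrow> 'a::{real_inner,complete_space}"
  assumes bdd: "bounded (range x)"
    and uniq: "\<And>p q. \<lbrakk>\<And>n. p \<in> closure (convex hull (x ` {n..}));
      \<And>n. q \<in> closure (convex hull (x ` {n..}))\<rbrakk> \<Longrightarrow> p = q"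
  shows "\<exists>p. (\<forall>n. p \<in> closure (convex hull (x ` {n..}))) \<and> weakly_converges x p"
proof -
  obtain p where p: "\<And>n. p \<in> closure (convex hull (x ` {n..}))"
    using tail_hulls_nonempty[OF bdd infinite_UNIV_nat] by auto
  have fin: "\<forall>\<^sub>F k in sequentially. inner (x k) z < inner p z + e" if "0 < e" for z e
  proof (rule ccontr)
    let ?K = "{k. inner p z + e \<le> inner (x k) z}"
    assume "\<not> (\<forall>\<^sub>F k in sequentially. inner (x k) z < inner p z + e)"
    then have "infinite ?K"
      by (simp add: not_less eventually_cofinite flip: cofinite_eq_sequentially)
    then obtain q where q: "\<And>n. q \<in> closure (convex hull (x ` (?K \<inter> {n..})))"
      using tail_hulls_nonempty[OF bdd, of ?K] by blast
    have "closure (convex hull (x ` (?K \<inter> {n..}))) \<subseteq> closure (convex hull (x ` {n..}))" for n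
      by (intro closure_mono hull_mono image_mono) auto
    then have "q = p" using uniq[of q p] q p by blast
    have "closure (convex hull (x ` (?K \<inter> {0..}))) \<subseteq> {v. inner z v \<ge> inner p z + e}"
      by (intro closure_convex_hull_subset closed_halfspace_ge convex_halfspace_ge)
        (auto simp: inner_commute)
    then show False using q[of 0] \<open>q = p\<close> that by (auto simp: inner_commute)
  qed
  have "(\<lambda>k. inner (x k) z) \<longlonglongrightarrow> inner p z" for z
  proof (rule tendstoI)
    fix e :: real assume "0 < e"
    have "\<forall>\<^sub>F k in sequentially. inner (x k) z < inner p z + e"
      "\<forall>\<^sub>F k in sequentially. inner (x k) (- z) < inner p (- z) + e"
      using fin \<open>0 < e\<close> by blast+
    then show "\<forall>\<^sub>F k in sequentially. dist (inner (x k) z) (inner p z) < e"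
    proof eventually_elim
      case (elim k)
      then have "inner (x k) z - inner p z < e" "- (inner (x k) z - inner p z) < e"
        by simp_all
      then show ?case unfolding dist_real_def abs_less_iff by blast
    qed
  qed
  then show ?thesis using p unfolding weakly_converges_def by blast
qed

section \<open>Real sequences\<close>

lemma decseq_bounded_below_tendsto:
  fixes X :: "nat \<Rightarrow> real"
  assumes "decseq X" "\<And>i. b \<le> X i"
  shows "\<exists>l. X \<longlonglongrightarrow> l \<and> (\<forall>i. l \<le> X i)"
  by (rule decseq_convergent[of X b]) (use assms in auto)

text \<open>Subtracting from \<open>a\<close> the partial sums of the errors gives a decreasing
  sequence bounded below by \<open>- suminf \<epsilon>\<close>; summing the steps bounds the partial
  sums of \<open>b\<close> by \<open>a 0 + suminf \<epsilon>\<close>.\<close>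

lemma fejer_sequence:
  fixes a b \<epsilon> :: "nat \<Rightarrow> real"
  assumes a: "\<And>k. 0 \<le> a k" and b: "\<And>k. 0 \<le> b k" and \<epsilon>: "\<And>k. 0 \<le> \<epsilon> k" "summable \<epsilon>"
    and step: "\<And>k. a (Suc k) \<le> a k + \<epsilon> k - b k"
  shows "convergent a" and "summable b"
proof -
  have part: "(\<Sum>j<k. \<epsilon> j) \<le> suminf \<epsilon>" for k
    using \<epsilon> by (intro sum_le_suminf) auto
  define s where "s = (\<lambda>k. a k - (\<Sum>j<k. \<epsilon> j))"
  have "decseq s"
    unfolding decseq_Suc_iff s_def
  proof
    fix k show "a (Suc k) - (\<Sum>j<Suc k. \<epsilon> j) \<le> a k - (\<Sum>j<k. \<epsilon> j)"
      using step[of k] b[of k] by simp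
  qed
  moreover have "- suminf \<epsilon> \<le> s k" for k
    using a[of k] part[of k] by (simp add: s_def)
  ultimately have "convergent s"
    unfolding convergent_def using decseq_bounded_below_tendsto by blast
  then have "convergent (\<lambda>k. s k + (\<Sum>j<k. \<epsilon> j))"
    using \<epsilon>(2) by (intro convergent_add) (auto simp: summable_iff_convergent)
  then show "convergent a" by (simp add: s_def)
  have "(\<Sum>j<k. b j) \<le> a 0 + (\<Sum>j<k. \<epsilon> j) - a k" for k
  proof (induction k)
    case (Suc k)
    then show ?case using step[of k] by simp
  qed simp
  then have "(\<Sum>j<k. b j) \<le> a 0 + suminf \<epsilon>" for k
    by (rule order_trans) (use part[of k] a[of k] in simp)
  then show "summable b"
    using b by (intro summableI_nonneg_bounded)
qed

text \<open>By monotonicity, each of the at least \<open>n / 2\<close> terms with index from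
  \<open>n div 2\<close> to \<open>n - 1\<close> dominates \<open>a n\<close>. Hence
  \<open>n * a n\<close> is at most twice the tail of the series from \<open>n div 2\<close>, which
  tends to 0.\<close>

lemma summable_decseq_smallo:
  fixes a :: "nat \<Rightarrow> real"
  assumes "decseq a" "\<And>k. 0 \<le> a k" "summable a"
  shows "a \<in> o(\<lambda>k. 1 / real k)"
proof (rule smalloI_tendsto)
  show "\<forall>\<^sub>F k in sequentially. 1 / real k \<noteq> 0"
    by (rule eventually_sequentiallyI[of 1]) simp
  define t where "t = (\<lambda>n. suminf a - (\<Sum>j<n. a j))"
  have "t \<longlonglongrightarrow> suminf a - suminf a"
    unfolding t_def by (intro tendsto_diff tendsto_const summable_LIMSEQ assms)
  then have "t \<longlonglongrightarrow> 0" by simp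
  moreover have "filterlim (\<lambda>n::nat. n div 2) at_top sequentially"
    unfolding filterlim_at_top
  proof
    fix m :: nat
    show "\<forall>\<^sub>F n in sequentially. m \<le> n div 2"
      by (rule eventually_sequentiallyI[of "2 * m"]) simp
  qed
  ultimately have "(\<lambda>n. t (n div 2)) \<longlonglongrightarrow> 0"
    by (rule filterlim_compose)
  then have lim: "(\<lambda>n. 2 * t (n div 2)) \<longlonglongrightarrow> 0"
    using tendsto_mult_right_zero by blast
  show "(\<lambda>k. a k / (1 / real k)) \<longlonglongrightarrow> 0"
  proof (rule tendsto_sandwich[OF _ _ tendsto_const lim])
    show "\<forall>\<^sub>F k in sequentially. 0 \<le> a k / (1 / real k)"
      using assms(2) by simp
    have "a n * real n \<le> 2 * t (n div 2)" for n
    proof -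
      have "real (n - n div 2) * a n = (\<Sum>j\<in>{n div 2..<n}. a n)" by simp
      also have "\<dots> \<le> (\<Sum>j\<in>{n div 2..<n}. a j)"
        using assms(1) by (intro sum_mono) (auto simp: decseq_def)
      also have "\<dots> = (\<Sum>j<n. a j) - (\<Sum>j<n div 2. a j)"
        by (simp add: sum_diff_nat_ivl lessThan_atLeast0)
      also have "\<dots> \<le> t (n div 2)"
        unfolding t_def using assms by (simp add: sum_le_suminf)
      finally have 1: "real (n - n div 2) * a n \<le> t (n div 2)" .
      have "real n \<le> 2 * real (n - n div 2)" by linarith
      then have "real n * a n \<le> 2 * real (n - n div 2) * a n"
        using assms(2) by (intro mult_right_mono)
      then have "a n * real n \<le> 2 * (real (n - n div 2) * a n)"
        by (simp only: mult.commute mult.left_commute mult.assoc)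
      then show ?thesis using 1 by linarith
    qed
    then show "\<forall>\<^sub>F k in sequentially. a k / (1 / real k) \<le> 2 * t (k div 2)"
      by simp
  qed
qed

text \<open>The form \<open>q k\<close> is divided by the product of the factors
  \<open>1 + \<eta> j\<close> with \<open>j < k\<close>. Summability keeps these products below
  \<open>exp (suminf \<eta>)\<close>, so the scaling stays away from zero.\<close>

lemma decreasing_rescaling:
  fixes q :: "nat \<Rightarrow> 'a \<Rightarrow> real"
  assumes \<eta>: "\<And>k. 0 \<le> \<eta> k" "summable \<eta>"
    and step: "\<And>k z. q (Suc k) z \<le> (1 + \<eta> k) * q k z" and q: "\<And>k z. 0 \<le> q k z"
  shows "\<exists>s c. 0 < c \<and> (\<forall>k. c \<le> s k \<and> s k \<le> 1) \<and> (\<forall>k z. s (Suc k) * q (Suc k) z \<le> s k * q k z)"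
proof -
  define P where "P = (\<lambda>k. \<Prod>j<k. 1 + \<eta> j)"
  have P1: "1 \<le> P k" for k
    unfolding P_def using \<eta>(1) by (intro prod_ge_1) auto
  have P2: "P k \<le> exp (suminf \<eta>)" for k
  proof -
    have "P k \<le> exp (\<Sum>j<k. \<eta> j)"
      unfolding P_def using \<eta>(1) by (intro prod_le_exp_sum) auto
    also have "\<dots> \<le> exp (suminf \<eta>)" using \<eta> by (simp add: sum_le_suminf)
    finally show ?thesis .
  qed
  have pos: "0 < P k" for k using P1[of k] by linarith
  show ?thesis
  proof (rule exI[of _ "\<lambda>k. 1 / P k"], rule exI[of _ "1 / exp (suminf \<eta>)"], intro conjI allI)
    show "1 / exp (suminf \<eta>) \<le> 1 / P k" for k
      using P2 pos by (intro divide_left_mono) auto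
    show "1 / P k \<le> 1" for k using P1[of k] by simp
    show "1 / P (Suc k) * q (Suc k) z \<le> 1 / P k * q k z" for k z
    proof -
      have S: "P (Suc k) = P k * (1 + \<eta> k)" by (simp add: P_def)
      have "1 / P (Suc k) * q (Suc k) z \<le> 1 / P (Suc k) * ((1 + \<eta> k) * q k z)"
        using step pos[of "Suc k"] by (intro mult_left_mono) auto
      also have "\<dots> = 1 / P k * q k z"
        using \<eta>(1)[of k] unfolding S by simp
      finally show ?thesis .
    qed
  qed simp
qed

section \<open>Smooth convex functions along segments\<close>

text \<open>Transfers the limit of extended-real quotients to an ordinary real derivative. It is
  taken within \<open>{0..1}\<close>, where convexity of \<open>D\<close> guarantees finite
  values.\<close>

lemma gateaux_gradient_along_segment:
  fixes f :: "'a::real_inner \<Rightarrow> ereal"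
  assumes f: "proper_fun f" and D: "convex D" "D \<subseteq> effective_domain f"
    and zw: "z \<in> D" "w \<in> D" and t: "t \<in> {0..1}"
    and u: "has_gateaux_gradient inner f (z + t *\<^sub>R (w - z)) u"
  shows "((\<lambda>s. real_of_ereal (f (z + s *\<^sub>R (w - z)))) has_real_derivative inner (w - z) u)
    (at t within {0..1})"
proof -
  define \<phi> where "\<phi> = (\<lambda>s. f (z + s *\<^sub>R (w - z)))"
  have fin: "\<phi> s = ereal (real_of_ereal (\<phi> s))" if "s \<in> {0..1}" for s
  proof -
    have "z + s *\<^sub>R (w - z) = (1 - s) *\<^sub>R z + s *\<^sub>R w" by (simp add: algebra_simps)
    also have "\<dots> \<in> D" using D(1) zw that unfolding convex_alt by auto
    finally show ?thesis
      unfolding \<phi>_def using D(2) ereal_real_effective_domain[OF f] by blast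
  qed
  have "((\<lambda>s. s - t) \<longlongrightarrow> t - t) (at t within {0..1})"
    by (intro tendsto_diff tendsto_ident_at tendsto_const)
  then have shift: "filterlim (\<lambda>s. s - t) (at 0) (at t within {0..1})"
    by (simp add: filterlim_at eventually_at_filter)
  have "((\<lambda>h. (f (z + t *\<^sub>R (w - z) + h *\<^sub>R (w - z)) - f (z + t *\<^sub>R (w - z))) / ereal h)
      \<longlongrightarrow> ereal (inner (w - z) u)) (at 0)"
    using u by (simp add: has_gateaux_gradient_def)
  from filterlim_compose[OF this shift] have "((\<lambda>s. (f (z + t *\<^sub>R (w - z) + (s - t) *\<^sub>R (w - z)) - f (z + t *\<^sub>R (w - z))) / ereal (s - t))
      \<longlongrightarrow> ereal (inner (w - z) u)) (at t within {0..1})"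
    .
  moreover have "z + t *\<^sub>R (w - z) + (s - t) *\<^sub>R (w - z) = z + s *\<^sub>R (w - z)" for s
    by (simp add: algebra_simps)
  ultimately have "((\<lambda>s. real_of_ereal ((\<phi> s - \<phi> t) / ereal (s - t))) \<longlongrightarrow> inner (w - z) u) (at t within {0..1})"
    by (simp only: \<phi>_def) (rule lim_real_of_ereal)
  moreover have "\<forall>\<^sub>F s in at t within {0..1}. real_of_ereal ((\<phi> s - \<phi> t) / ereal (s - t))
      = (real_of_ereal (\<phi> s) - real_of_ereal (\<phi> t)) / (s - t)"
    unfolding eventually_at_filter
  proof (intro always_eventually allI impI)
    fix s assume "s \<noteq> t" and s: "s \<in> {0..1}"
    obtain a b where "\<phi> s = ereal a" "\<phi> t = ereal b" using fin s t by meson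
    then show "real_of_ereal ((\<phi> s - \<phi> t) / ereal (s - t))
      = (real_of_ereal (\<phi> s) - real_of_ereal (\<phi> t)) / (s - t)"
      using \<open>s \<noteq> t\<close> by simp
  qed
  ultimately show ?thesis
    unfolding has_field_derivative_iff by (simp add: \<phi>_def tendsto_cong)
qed

lemma has_derivative_le_chord:
  fixes \<phi> :: "real \<Rightarrow> real"
  assumes der: "(\<phi> has_real_derivative c) (at 0 within {0..1})"
    and chord: "\<And>s. 0 < s \<Longrightarrow> s \<le> 1 \<Longrightarrow> \<phi> s \<le> (1 - s) * \<phi> 0 + s * \<phi> 1"
  shows "\<phi> 0 + c \<le> \<phi> 1"
proof -
  have "c \<le> \<phi> 1 - \<phi> 0"
  proof (rule tendsto_upperbound)
    show "((\<lambda>s. (\<phi> s - \<phi> 0) / (s - 0)) \<longlongrightarrow> c) (at 0 within {0..1})"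
      using der unfolding has_field_derivative_iff .
    show "\<forall>\<^sub>F s in at 0 within {0..1}. (\<phi> s - \<phi> 0) / (s - 0) \<le> \<phi> 1 - \<phi> 0"
      unfolding eventually_at_filter
    proof (intro always_eventually allI impI)
      fix s :: real assume "s \<noteq> 0" "s \<in> {0..1}"
      then have "0 < s" "s \<le> 1" by auto
      then have "0 < s" "\<phi> s - \<phi> 0 \<le> (\<phi> 1 - \<phi> 0) * s"
        using chord[of s] by (auto simp: algebra_simps)
      then show "(\<phi> s - \<phi> 0) / (s - 0) \<le> \<phi> 1 - \<phi> 0"
        by (simp only: diff_zero pos_divide_le_eq)
    qed
    show "at (0::real) within {0..1} \<noteq> bot" by (simp add: at_within_Icc_at_right)
  qed
  then show ?thesis by simp
qed

text \<open>The mean value theorem is applied to \<open>\<phi>\<close> minus the quadratic bound,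
  whose derivative is nonpositive; no integration of \<open>\<phi>'\<close> is involved.\<close>

lemma quadratic_upper_bound:
  fixes \<phi> :: "real \<Rightarrow> real"
  assumes der: "\<And>t. t \<in> {0..1} \<Longrightarrow> (\<phi> has_real_derivative \<phi>' t) (at t within {0..1})"
    and lip: "\<And>t. t \<in> {0..1} \<Longrightarrow> \<phi>' t \<le> \<phi>' 0 + K * t"
  shows "\<phi> 1 \<le> \<phi> 0 + \<phi>' 0 + K / 2"
proof -
  have "\<exists>t\<in>{0..1}. (\<phi> 1 - \<phi>' 0 * 1 - K / 2 * 1\<^sup>2) - (\<phi> 0 - \<phi>' 0 * 0 - K / 2 * 0\<^sup>2)
      = (\<lambda>t h. h * (\<phi>' t - \<phi>' 0 - K * t)) t (1 - 0)"
  proof (rule mvt_very_simple)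
    fix t :: real assume "0 \<le> t" "t \<le> 1"
    then have "((\<lambda>t. \<phi> t - \<phi>' 0 * t - K / 2 * t\<^sup>2) has_real_derivative \<phi>' t - \<phi>' 0 - K * t) (at t within {0..1})"
      by (auto intro!: derivative_eq_intros der)
    then show "((\<lambda>t. \<phi> t - \<phi>' 0 * t - K / 2 * t\<^sup>2) has_derivative (\<lambda>h. h * (\<phi>' t - \<phi>' 0 - K * t))) (at t within {0..1})"
      unfolding has_field_derivative_def by (rule has_derivative_eq_rhs) auto
  qed simp
  then show ?thesis using lip by force
qed

text \<open>Both bounds are statements about \<open>f\<close> on the segment from \<open>z\<close>
  to \<open>w\<close>. Since it stays in \<open>D\<close>, differentiability and the Lipschitz
  estimate on \<open>D\<close> apply at each of its points.\<close>

lemma lipschitz_gradient_bounds: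
  fixes f :: "'a::real_inner \<Rightarrow> ereal"
  assumes f: "proper_fun f" "convex_fun f"
    and D: "convex D" "D \<subseteq> effective_domain f"
    and diff: "\<forall>z\<in>D. gateaux_differentiable f z"
    and lip: "lipschitz_on L D (gateaux_gradient inner f)"
    and zw: "z \<in> D" "w \<in> D"
  shows "real_of_ereal (f z) + inner (w - z) (gateaux_gradient inner f z) \<le> real_of_ereal (f w)"
    and "real_of_ereal (f w) \<le> real_of_ereal (f z) + inner (w - z) (gateaux_gradient inner f z)
      + L / 2 * (norm (w - z))\<^sup>2"
proof -
  let ?g = "gateaux_gradient inner f"
  have grad: "has_gateaux_gradient inner f v (?g v)" if "v \<in> D" for v
  proof -
    from bspec[OF diff that] obtain u where u: "has_gateaux_gradient inner f v u"
      unfolding gateaux_differentiable_def ..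
    show ?thesis
      unfolding gateaux_gradient_def
      by (rule theI[of _ u], rule u, rule has_gateaux_gradient_inner_unique[OF _ u])
  qed
  define \<phi> where "\<phi> = (\<lambda>s. real_of_ereal (f (z + s *\<^sub>R (w - z))))"
  have seg: "z + s *\<^sub>R (w - z) = (1 - s) *\<^sub>R z + s *\<^sub>R w" for s by (simp add: algebra_simps)
  have inD: "z + s *\<^sub>R (w - z) \<in> D" if "s \<in> {0..1}" for s
    unfolding seg using D(1) zw that unfolding convex_alt by auto
  have der: "(\<phi> has_real_derivative inner (w - z) (?g (z + t *\<^sub>R (w - z)))) (at t within {0..1})"
    if "t \<in> {0..1}" for t
    unfolding \<phi>_def by (rule gateaux_gradient_along_segment[OF f(1) D zw that grad[OF inD[OF that]]])
  have "\<phi> 0 + inner (w - z) (?g z) \<le> \<phi> 1"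
  proof (rule has_derivative_le_chord)
    show "(\<phi> has_real_derivative inner (w - z) (?g z)) (at 0 within {0..1})"
      using der[of 0] by simp
    fix s :: real assume "0 < s" "s \<le> 1"
    then show "\<phi> s \<le> (1 - s) * \<phi> 0 + s * \<phi> 1"
      using convex_onD[OF convex_effective_domain(2)[OF f], of s z w] zw D(2)
      unfolding \<phi>_def seg by (auto simp: algebra_simps)
  qed
  then show "real_of_ereal (f z) + inner (w - z) (?g z) \<le> real_of_ereal (f w)"
    by (simp add: \<phi>_def)
  have "\<phi> 1 \<le> \<phi> 0 + inner (w - z) (?g (z + 0 *\<^sub>R (w - z))) + (L * (norm (w - z))\<^sup>2) / 2"
  proof (rule quadratic_upper_bound[OF der])
    fix t :: real assume t: "t \<in> {0..1}"
    have "inner (w - z) (?g (z + t *\<^sub>R (w - z)) - ?g z) \<le> norm (w - z) * norm (?g (z + t *\<^sub>R (w - z)) - ?g z)"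
      by (rule norm_cauchy_schwarz)
    also have "\<dots> \<le> norm (w - z) * (L * (t * norm (w - z)))"
      using lipschitz_onD[OF lip inD[OF t] zw(1)] t
      by (intro mult_left_mono) (auto simp: dist_norm)
    finally show "inner (w - z) (?g (z + t *\<^sub>R (w - z)))
        \<le> inner (w - z) (?g (z + 0 *\<^sub>R (w - z))) + L * (norm (w - z))\<^sup>2 * t"
      by (simp add: inner_diff_right power2_eq_square mult_ac)
  qed
  then show "real_of_ereal (f w) \<le> real_of_ereal (f z) + inner (w - z) (?g z) + L / 2 * (norm (w - z))\<^sup>2"
    by (simp add: \<phi>_def)
qed

section \<open>The iteration with decreasing metrics\<close>

text \<open>An extract of the problem in real arithmetic. \<open>D\<close> stands for the domain of
  \<open>g\<close>, the proximal step is present only through its variational inequality, and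
  semicontinuity only through closed sublevel sets of the sum. \<open>B\<close> and
  \<open>\<gamma>\<close> are meant to be the rescaled metrics and steps; \<open>nv k\<close> is the
  sharp individual lower bound entering the step condition, \<open>nu0\<close> a uniform one, and
  \<open>c\<close> records the strict gap to \<open>2 / L\<close>.\<close>

locale forward_backward =
  fixes D :: "'a::{real_inner,complete_space} set" and F G :: "'a \<Rightarrow> real" and grad :: "'a \<Rightarrow> 'a"
    and B :: "nat \<Rightarrow> 'a \<Rightarrow> 'a \<Rightarrow> real" and nv \<gamma> lam :: "nat \<Rightarrow> real" and x y :: "nat \<Rightarrow> 'a"
    and L nu0 mu g0 g1 l0 c :: real
  assumes F_convex: "convex_on D F" and G_convex: "convex_on D G"
    and closed_sublevel: "\<And>r. closed {z \<in> D. F z + G z \<le> r}"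
    and F_gradient: "\<And>z w. z \<in> D \<Longrightarrow> w \<in> D \<Longrightarrow> F z + inner (w - z) (grad z) \<le> F w"
    and F_descent: "\<And>z w. z \<in> D \<Longrightarrow> w \<in> D \<Longrightarrow>
      F w \<le> F z + inner (w - z) (grad z) + L / 2 * (norm (w - z))\<^sup>2"
    and L: "0 \<le> L"
    and scalar_product: "\<And>k. is_scalar_product (B k)"
    and B_lower: "\<And>k z. nv k * (norm z)\<^sup>2 \<le> B k z z" and nv: "0 < nu0" "\<And>k. nu0 \<le> nv k"
    and B_upper: "\<And>k z. B k z z \<le> mu * (norm z)\<^sup>2" and mu: "0 < mu"
    and B_decreasing: "\<And>k z. B (Suc k) z z \<le> B k z z"
    and \<gamma>: "0 < g0" "\<And>k. g0 \<le> \<gamma> k" "\<And>k. \<gamma> k \<le> g1"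
    and lam: "0 < l0" "\<And>k. l0 \<le> lam k" "\<And>k. lam k \<le> 1"
    and step: "\<And>k. \<gamma> k * lam k \<le> c * nv k" "0 < c" "c * L < 2"
    and x_0: "x 0 \<in> D" and y_D: "\<And>k. y k \<in> D"
    and x_Suc: "\<And>k. x (Suc k) = x k + lam k *\<^sub>R (y k - x k)"
    and y_variational: "\<And>k z. z \<in> D \<Longrightarrow>
      B k (z - y k) (x k - y k) \<le> \<gamma> k * (G z - G (y k) + inner (z - y k) (grad (x k)))"
begin

section \<open>Notation and immediate consequences of the assumptions\<close>

definition obj :: "'a \<Rightarrow> real" where "obj z = F z + G z"

definition d :: "nat \<Rightarrow> 'a" where "d k = y k - x k"

definition minimal :: "'a \<Rightarrow> bool" where "minimal s \<longleftrightarrow> s \<in> D \<and> (\<forall>w\<in>D. obj s \<le> obj w)"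

lemma B_bounded_bilinear: "bounded_bilinear (B k)"
  by (rule scalar_product_bounded_bilinear[OF scalar_product B_upper])

lemma B_sym: "B k u v = B k v u"
  using scalar_product by (auto simp: is_scalar_product_def)

lemma B_nonneg: "0 \<le> B k u u"
  by (rule scalar_product_nonneg[OF scalar_product])

lemma B_lower0: "nu0 * (norm z)\<^sup>2 \<le> B k z z"
  using mult_right_mono[OF nv(2)[of k], of "(norm z)\<^sup>2"] B_lower[of k z] by simp

lemma \<gamma>_pos: "0 < \<gamma> k" using \<gamma>(1,2) less_le_trans by blast

lemma lam_pos: "0 < lam k" using lam(1,2) less_le_trans by blast

lemma x_Suc': "x (Suc k) = (1 - lam k) *\<^sub>R x k + lam k *\<^sub>R y k"
  by (simp add: x_Suc algebra_simps)

lemma x_D: "x k \<in> D"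
proof (induction k)
  case (Suc k)
  then show ?case
    using F_convex y_D lam_pos[of k] lam(3)[of k]
    unfolding x_Suc' convex_on_def convex_alt by auto
qed (rule x_0)

section \<open>Decrease of the objective along the iteration\<close>

lemma y_decrease: "B k (d k) (d k) \<le> \<gamma> k * (G (x k) - G (y k) - inner (d k) (grad (x k)))"
proof -
  interpret B: bounded_bilinear "B k" by (rule B_bounded_bilinear)
  have "x k - y k = - d k" by (simp add: d_def)
  then show ?thesis using y_variational[OF x_D, of k k] by (simp add: B.minus_left B.minus_right)
qed

text \<open>Convexity of \<open>G\<close> and the descent inequality for \<open>F\<close> are both
  applied along the relaxed step. The quadratic term thus carries \<open>(lam k)\<^sup>2\<close>
  against a single \<open>lam k\<close> in the gain, which is what makes a condition on
  \<open>\<gamma> k * lam k\<close> sufficient.\<close>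

lemma obj_step: "obj (x (Suc k)) \<le> obj (x k)
    - lam k * (G (x k) - G (y k) - inner (d k) (grad (x k))) + L / 2 * (lam k)\<^sup>2 * (norm (d k))\<^sup>2"
proof -
  have "G (x (Suc k)) \<le> (1 - lam k) * G (x k) + lam k * G (y k)"
    unfolding x_Suc' using convex_onD[OF G_convex, of "lam k" "x k" "y k"] x_D y_D lam_pos[of k] lam(3)[of k] by simp
  moreover have "F (x (Suc k)) \<le> F (x k) + inner (lam k *\<^sub>R d k) (grad (x k)) + L / 2 * (norm (lam k *\<^sub>R d k))\<^sup>2"
    using F_descent[OF x_D x_D, of "Suc k" k] by (simp add: x_Suc d_def)
  ultimately show ?thesis
    by (simp add: obj_def power_mult_distrib algebra_simps)
qed

text \<open>The term \<open>1 / c\<close> comes from the gain of the proximal step,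
  \<open>L / 2\<close> is the loss in the descent inequality, and \<open>l0\<close> bounds the
  relaxation parameters from below. The assumption \<open>c * L < 2\<close> says that the gain
  wins.\<close>

definition \<delta> :: real where "\<delta> = l0\<^sup>2 * (1 / c - L / 2)"

lemma \<delta>_pos: "0 < \<delta>"
  using lam(1) step(2,3) by (simp add: \<delta>_def field_simps)

lemma obj_decrease: "obj (x (Suc k)) + \<delta> * (norm (d k))\<^sup>2 \<le> obj (x k)"
proof -
  define A where "A = G (x k) - G (y k) - inner (d k) (grad (x k))"
  \<comment> \<open>The step condition is inserted before dividing by \<open>\<gamma> k\<close>: the
    step size then cancels, and \<open>A\<close> is bounded below in terms of \<open>lam k\<close>
    and \<open>c\<close> alone.\<close>
  have "\<gamma> k * (lam k * (norm (d k))\<^sup>2) \<le> c * (nv k * (norm (d k))\<^sup>2)"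
    using mult_right_mono[OF step(1), of "(norm (d k))\<^sup>2" k] by (simp add: mult.assoc)
  also have "\<dots> \<le> c * (\<gamma> k * A)"
    using step(2) order_trans[OF B_lower y_decrease] unfolding A_def by simp
  finally have "\<gamma> k * (lam k * (norm (d k))\<^sup>2) \<le> \<gamma> k * (c * A)" by (simp add: mult_ac)
  then have "lam k * (norm (d k))\<^sup>2 \<le> c * A" using \<gamma>_pos[of k] by simp
  then have "lam k * (norm (d k))\<^sup>2 / c \<le> A" using step(2) by (simp add: field_simps)
  then have "lam k * (lam k * (norm (d k))\<^sup>2 / c) \<le> lam k * A"
    using lam_pos[of k] by (intro mult_left_mono) auto
  then have 1: "(lam k)\<^sup>2 * (norm (d k))\<^sup>2 / c \<le> lam k * A"
    by (simp add: power2_eq_square mult.assoc)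
  have pos: "0 \<le> 1 / c - L / 2" using \<delta>_pos unfolding \<delta>_def by (simp add: zero_less_mult_iff)
  have "l0\<^sup>2 \<le> (lam k)\<^sup>2" using lam by (intro power_mono) auto
  then have "\<delta> * (norm (d k))\<^sup>2 \<le> (lam k)\<^sup>2 * (1 / c - L / 2) * (norm (d k))\<^sup>2"
    unfolding \<delta>_def using pos by (intro mult_right_mono) auto
  also have "\<dots> = (lam k)\<^sup>2 * (norm (d k))\<^sup>2 / c - L / 2 * (lam k)\<^sup>2 * (norm (d k))\<^sup>2"
    by (simp add: algebra_simps)
  finally show ?thesis
    using 1 obj_step[of k] unfolding A_def[symmetric] by linarith
qed

lemma decseq_obj: "decseq (\<lambda>k. obj (x k))"
  unfolding decseq_Suc_iff
proof
  fix k
  have "0 \<le> \<delta> * (norm (d k))\<^sup>2" using \<delta>_pos by simp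
  then show "obj (x (Suc k)) \<le> obj (x k)" using obj_decrease[of k] by linarith
qed

lemma summable_steps:
  assumes "\<And>k. m \<le> obj (x k)"
  shows "summable (\<lambda>k. (norm (d k))\<^sup>2)" and "summable (\<lambda>k. obj (x k) - obj (x (Suc k)))"
proof -
  have "summable (\<lambda>k. \<delta> * (norm (d k))\<^sup>2)"
  proof (rule fejer_sequence(2)[where a = "\<lambda>k. obj (x k) - m" and \<epsilon> = "\<lambda>_. 0"])
    show "obj (x (Suc k)) - m \<le> obj (x k) - m + 0 - \<delta> * (norm (d k))\<^sup>2" for k
      using obj_decrease[of k] by simp
  qed (use assms \<delta>_pos in auto)
  then show "summable (\<lambda>k. (norm (d k))\<^sup>2)" using \<delta>_pos by (simp add: summable_cmult_iff)
  show "summable (\<lambda>k. obj (x k) - obj (x (Suc k)))"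
    by (rule fejer_sequence(2)[where a = "\<lambda>k. obj (x k) - m" and \<epsilon> = "\<lambda>_. 0"])
      (use assms decseq_obj in \<open>auto simp: decseq_Suc_iff\<close>)
qed

text \<open>The squared distance after the step is expanded in the metric \<open>B k\<close>. The
  mixed term is bounded by the variational inequality at \<open>z\<close> and the gradient
  inequality for \<open>F\<close>; the quantity \<open>A\<close> that appears is traded for a
  decrease of the objective by \<open>obj_step\<close>. Only at the end is the metric replaced by
  \<open>B (Suc k)\<close>.\<close>

lemma distance_step:
  assumes z: "z \<in> D"
  shows "B (Suc k) (x (Suc k) - z) (x (Suc k) - z) \<le> B k (x k - z) (x k - z)
    + (mu * (norm (d k))\<^sup>2 + 2 * g1 * (obj (x k) - obj (x (Suc k))))
    - 2 * \<gamma> k * lam k * (obj (x k) - obj z)"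
proof -
  interpret B: bounded_bilinear "B k" by (rule B_bounded_bilinear)
  define A where "A = G (x k) - G (y k) - inner (d k) (grad (x k))"
  define Bd where "Bd = B k (d k) (d k)"
  have "inner (z - x k) (grad (x k)) \<le> F z - F (x k)"
    using F_gradient[OF x_D z, of k] by simp
  moreover have "z - y k = (z - x k) - d k" by (simp add: d_def)
  then have "inner (z - y k) (grad (x k)) = inner (z - x k) (grad (x k)) - inner (d k) (grad (x k))"
    by (metis inner_diff_left)
  ultimately have "G z - G (y k) + inner (z - y k) (grad (x k)) \<le> obj z - obj (x k) + A"
    unfolding A_def obj_def by linarith
  then have "\<gamma> k * (G z - G (y k) + inner (z - y k) (grad (x k))) \<le> \<gamma> k * (obj z - obj (x k) + A)"
    using \<gamma>_pos[of k] by simp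
  then have "B k (z - y k) (x k - y k) \<le> \<gamma> k * (obj z - obj (x k) + A)"
    using y_variational[OF z, of k] by linarith
  \<comment> \<open>Writing \<open>x k - z\<close> as \<open>(y k - z) - d k\<close> produces the
    term \<open>- Bd\<close>, which later absorbs the Lipschitz error.\<close>
  moreover have "B k (x k - z) (d k) = - Bd + B k (z - y k) (x k - y k)"
    unfolding Bd_def d_def
    by (simp add: B.diff_left B.diff_right)
  ultimately have inner_le: "B k (x k - z) (d k) \<le> - Bd + \<gamma> k * (obj z - obj (x k) + A)"
    by linarith
  have "x (Suc k) - z = (x k - z) + lam k *\<^sub>R d k" by (simp add: x_Suc d_def)
  then have expand: "B k (x (Suc k) - z) (x (Suc k) - z)
      = B k (x k - z) (x k - z) + 2 * lam k * B k (x k - z) (d k) + (lam k)\<^sup>2 * Bd"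
    unfolding Bd_def using B_sym[of k "d k" "x k - z"]
    by (simp only: B.add_left B.add_right B.scaleR_left B.scaleR_right)
      (simp add: power2_eq_square algebra_simps)
  have Bd: "0 \<le> Bd" "Bd \<le> mu * (norm (d k))\<^sup>2" "nv k * (norm (d k))\<^sup>2 \<le> Bd"
    unfolding Bd_def by (rule B_nonneg B_upper B_lower)+
  have 1: "2 * lam k * B k (x k - z) (d k) \<le> 2 * lam k * (- Bd + \<gamma> k * (obj z - obj (x k) + A))"
    using inner_le lam_pos[of k] by simp
  have "lam k * A \<le> obj (x k) - obj (x (Suc k)) + L / 2 * (lam k)\<^sup>2 * (norm (d k))\<^sup>2"
    using obj_step[of k] unfolding A_def by linarith
  then have "2 * \<gamma> k * (lam k * A) \<le> 2 * \<gamma> k * (obj (x k) - obj (x (Suc k)) + L / 2 * (lam k)\<^sup>2 * (norm (d k))\<^sup>2)"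
    using \<gamma>_pos[of k] by simp
  then have 2: "2 * \<gamma> k * (lam k * A) \<le> 2 * \<gamma> k * (obj (x k) - obj (x (Suc k))) + L * lam k * ((\<gamma> k * lam k) * (norm (d k))\<^sup>2)"
    by (simp add: algebra_simps power2_eq_square)
  have "(\<gamma> k * lam k) * (norm (d k))\<^sup>2 \<le> c * Bd"
  proof -
    have "(\<gamma> k * lam k) * (norm (d k))\<^sup>2 \<le> c * nv k * (norm (d k))\<^sup>2"
      using step(1) by (intro mult_right_mono) auto
    also have "\<dots> \<le> c * Bd" using Bd(3) step(2) by (simp add: mult.assoc)
    finally show ?thesis .
  qed
  \<comment> \<open>Since \<open>c * L < 2\<close>, the curvature error is at most
    \<open>2 * (lam k * Bd)\<close>, exactly the negative term provided by the mixed
    product.\<close>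
  then have "L * lam k * ((\<gamma> k * lam k) * (norm (d k))\<^sup>2) \<le> L * lam k * (c * Bd)"
    using L lam_pos[of k] by (intro mult_left_mono) auto
  also have "\<dots> = (c * L) * (lam k * Bd)" by simp
  also have "\<dots> \<le> 2 * (lam k * Bd)"
    using step(3) lam_pos[of k] Bd(1) by (intro mult_right_mono) auto
  finally have 3: "L * lam k * ((\<gamma> k * lam k) * (norm (d k))\<^sup>2) \<le> 2 * (lam k * Bd)" .
  have "(lam k)\<^sup>2 \<le> 1" using lam_pos[of k] lam(3)[of k] by (simp add: power_le_one)
  then have 4: "(lam k)\<^sup>2 * Bd \<le> mu * (norm (d k))\<^sup>2"
    using mult_right_mono[of "(lam k)\<^sup>2" 1 Bd] Bd by linarith
  \<comment> \<open>The decrease of the objective is nonnegative, so the varying step may be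
    replaced by its upper bound; the resulting errors telescope.\<close>
  have 5: "2 * \<gamma> k * (obj (x k) - obj (x (Suc k))) \<le> 2 * g1 * (obj (x k) - obj (x (Suc k)))"
    using \<gamma>(3) decseq_obj by (intro mult_right_mono) (auto simp: decseq_Suc_iff)
  have "2 * lam k * (- Bd + \<gamma> k * (obj z - obj (x k) + A))
      = - 2 * (lam k * Bd) - 2 * \<gamma> k * lam k * (obj (x k) - obj z) + 2 * \<gamma> k * (lam k * A)"
    by (simp add: algebra_simps)
  then show ?thesis
    using B_decreasing[of k "x (Suc k) - z"] expand 1 2 3 4 5 by linarith
qed

text \<open>The bound by \<open>obj z\<close> has two uses: it makes the errors in the distance
  estimate summable, and it makes the subtracted terms nonnegative.\<close>

lemma fejer:
  assumes z: "z \<in> D" and le: "\<And>k. obj z \<le> obj (x k)"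
  shows "convergent (\<lambda>k. B k (x k - z) (x k - z))" and "summable (\<lambda>k. obj (x k) - obj z)"
proof -
  let ?\<epsilon> = "\<lambda>k. mu * (norm (d k))\<^sup>2 + 2 * g1 * (obj (x k) - obj (x (Suc k)))"
  let ?b = "\<lambda>k. 2 * \<gamma> k * lam k * (obj (x k) - obj z)"
  have g1: "0 \<le> g1" using \<gamma>_pos[of 0] \<gamma>(3)[of 0] by linarith
  have \<epsilon>: "0 \<le> ?\<epsilon> k" for k
    using mu g1 decseq_obj by (simp add: decseq_Suc_iff)
  have s\<epsilon>: "summable ?\<epsilon>"
    using summable_steps[OF le] by (intro summable_add summable_mult)
  have b: "0 \<le> ?b k" for k
    using le[of k] \<gamma>_pos[of k] lam_pos[of k] by simp
  show "convergent (\<lambda>k. B k (x k - z) (x k - z))"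
    by (rule fejer_sequence(1)[OF B_nonneg b \<epsilon> s\<epsilon> distance_step[OF z]])
  have "summable ?b"
    by (rule fejer_sequence(2)[OF B_nonneg b \<epsilon> s\<epsilon> distance_step[OF z]])
  \<comment> \<open>The lower bounds on steps and relaxation parameters strip the weights from the
    summable gaps.\<close>
  then have "summable (\<lambda>k. 2 * g0 * l0 * (obj (x k) - obj z))"
  proof (rule summable_comparison_test_ev[rotated])
    show "\<forall>\<^sub>F k in sequentially. norm (2 * g0 * l0 * (obj (x k) - obj z)) \<le> ?b k"
    proof (intro always_eventually allI)
      fix k
      have "2 * g0 * l0 * (obj (x k) - obj z) \<le> ?b k"
        using \<gamma> lam \<gamma>_pos[of k] le[of k] by (intro mult_right_mono mult_mono) auto
      then show "norm (2 * g0 * l0 * (obj (x k) - obj z)) \<le> ?b k"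
        using \<gamma>(1) lam(1) le[of k] by simp
    qed
  qed
  then show "summable (\<lambda>k. obj (x k) - obj z)"
    using \<gamma>(1) lam(1) by (simp add: summable_cmult_iff)
qed

section \<open>Values of the iterates and the infimum\<close>

lemma obj_tendsto:
  assumes "z \<in> D" "\<And>k. obj z \<le> obj (x k)"
  shows "(\<lambda>k. obj (x k)) \<longlonglongrightarrow> obj z"
  using summable_LIMSEQ_zero[OF fejer(2)[OF assms]] by (simp add: LIM_zero_iff)

text \<open>If all values stayed above \<open>obj z + e\<close>, they would be bounded below by
  \<open>obj z\<close> and hence converge to \<open>obj z\<close>, which is absurd. The negated
  claim itself supplies the lower bound needed for summability.\<close>

lemma obj_near_infimum:
  assumes "z \<in> D" "0 < e"
  shows "\<exists>k. obj (x k) < obj z + e"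
proof (rule ccontr)
  assume "\<not> ?thesis"
  then have le: "obj z + e \<le> obj (x k)" for k by (simp add: not_less)
  have "obj z \<le> obj (x k)" for k using le[of k] assms(2) by linarith
  then have "(\<lambda>k. obj (x k)) \<longlonglongrightarrow> obj z"
    by (rule obj_tendsto[OF assms(1)])
  then have "obj z + e \<le> obj z"
    by (rule LIMSEQ_le_const) (use le in blast)
  then show False using assms(2) by simp
qed

lemma minimal_if_below:
  assumes "p \<in> D" "\<And>k. obj p \<le> obj (x k)"
  shows "minimal p"
  unfolding minimal_def
proof (intro conjI ballI)
  fix w assume w: "w \<in> D"
  show "obj p \<le> obj w"
  proof (rule field_le_epsilon)
    fix e :: real assume "0 < e"
    then obtain k where "obj (x k) < obj w + e" using obj_near_infimum[OF w] by blast
    then show "obj p \<le> obj w + e" using assms(2)[of k] by linarith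
  qed
qed fact

section \<open>Sublevel sets, cluster points and the case without minimisers\<close>

lemma convex_sublevel: "convex {z \<in> D. obj z \<le> r}"
proof -
  have conv: "convex_on D obj"
    unfolding obj_def[abs_def] by (intro convex_on_add F_convex G_convex)
  show ?thesis
  proof (rule convexI)
    fix a b and u v :: real
    assume ab: "a \<in> {z \<in> D. obj z \<le> r}" "b \<in> {z \<in> D. obj z \<le> r}"
      and uv: "0 \<le> u" "0 \<le> v" "u + v = 1"
    have "obj (u *\<^sub>R a + v *\<^sub>R b) \<le> max (obj a) (obj b)"
      using ab uv by (intro convex_lower[OF conv]) auto
    moreover have "u *\<^sub>R a + v *\<^sub>R b \<in> D"
      using ab uv by (intro convexD[OF convex_on_imp_convex[OF conv]]) auto
    ultimately show "u *\<^sub>R a + v *\<^sub>R b \<in> {z \<in> D. obj z \<le> r}"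
      using ab by auto
  qed
qed

lemma closed_sublevel': "closed {z \<in> D. obj z \<le> r}"
  using closed_sublevel by (simp add: obj_def)

text \<open>The sublevel set at the value \<open>obj (x k)\<close> is closed and convex and contains
  the tail from \<open>k\<close> on, hence also the closed convex hull of that tail.\<close>

lemma cluster_minimal:
  assumes p: "\<And>n. p \<in> closure (convex hull (x ` {n..}))"
  shows "minimal p"
proof -
  have "p \<in> {z \<in> D. obj z \<le> obj (x k)}" for k
  proof -
    have "closure (convex hull (x ` {k..})) \<subseteq> {z \<in> D. obj z \<le> obj (x k)}"
      using x_D decseq_obj
      by (intro closure_convex_hull_subset closed_sublevel' convex_sublevel) (auto simp: decseq_def)
    then show ?thesis using p by blast
  qed
  then show ?thesis by (intro minimal_if_below) auto
qed

lemma norm_tendsto_infinity: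
  assumes "\<nexists>s. minimal s"
  shows "filterlim (\<lambda>k. norm (x k)) at_top sequentially"
proof (rule ccontr)
  assume "\<not> ?thesis"
  then obtain R where "\<not> (\<forall>\<^sub>F k in sequentially. R \<le> norm (x k))"
    unfolding filterlim_at_top by blast
  then have R: "\<exists>k\<ge>n. norm (x k) < R" for n
    by (auto simp: eventually_sequentially not_le)
  define C where "C = (\<lambda>n. {z \<in> D. obj z \<le> obj (x n)} \<inter> cball 0 R)"
  have "\<exists>p. \<forall>n. p \<in> C n"
  proof (rule nested_closed_convex_nonempty)
    show "C n \<noteq> {}" for n
    proof -
      obtain k where "n \<le> k" "norm (x k) < R" using R by blast
      then have "x k \<in> C n"
        using x_D decseq_obj by (auto simp: C_def decseq_def)
      then show ?thesis by blast
    qed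
    show "C n \<subseteq> C m" if "m \<le> n" for m n
    proof -
      have "obj (x n) \<le> obj (x m)" using decseq_obj that by (simp add: decseq_def)
      then show ?thesis by (auto simp: C_def)
    qed
    show "closed (C n)" for n
      unfolding C_def by (intro closed_Int closed_sublevel' closed_cball)
    show "convex (C n)" for n
      unfolding C_def by (intro convex_Int convex_sublevel convex_cball)
    show "bounded (C 0)"
      unfolding C_def by (intro bounded_Int disjI2 bounded_cball)
  qed
  then obtain p where p: "\<forall>n. p \<in> C n" ..
  have "minimal p" by (rule minimal_if_below) (use p in \<open>auto simp: C_def\<close>)
  then show False using assms by blast
qed

section \<open>Weak convergence, values and rate in the presence of a minimiser\<close>

context
  fixes s assumes s: "minimal s"
begin

lemma minimal_below: "obj s \<le> obj (x k)"
  using s x_D by (simp add: minimal_def)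

lemma bounded_x: "bounded (range x)"
proof -
  have "Bseq (\<lambda>k. B k (x k - s) (x k - s))"
    using s by (intro convergent_imp_Bseq fejer minimal_below) (simp add: minimal_def)
  then obtain K where K: "0 < K" "\<And>k. norm (B k (x k - s) (x k - s)) \<le> K"
    by (auto simp: Bseq_def)
  have "dist s (x k) \<le> sqrt (K / nu0)" for k
  proof -
    have "nu0 * (norm (x k - s))\<^sup>2 \<le> K"
      using B_lower0[of "x k - s" k] K(2)[of k] by simp
    then have "(norm (x k - s))\<^sup>2 \<le> K / nu0"
      using nv(1) by (simp add: field_simps)
    then show ?thesis
      by (simp add: dist_norm norm_minus_commute real_le_rsqrt)
  qed
  then show ?thesis unfolding bounded_def by blast
qed

lemma B_convergent: "convergent (\<lambda>k. B k z z)"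
proof -
  have "decseq (\<lambda>k. B k z z)" using B_decreasing by (simp add: decseq_Suc_iff)
  then show ?thesis
    unfolding convergent_def using decseq_bounded_below_tendsto[of "\<lambda>k. B k z z" 0] B_nonneg by blast
qed

text \<open>Opial's argument with varying metrics. For \<open>v = q - p\<close>, convergence of both
  squared distances makes \<open>B k (x k) v\<close> converge, but this functional depends on
  \<open>k\<close>. As \<open>B j - B k\<close> is positive semidefinite for
  \<open>j \<le> k\<close>, Cauchy-Schwarz bounds its value at \<open>x k\<close> and
  \<open>v\<close> through \<open>B j v v - B k v v\<close>, which is small for one fixed
  \<open>j\<close> and all later \<open>k\<close>. The tail, and with it both cluster points, then
  lies in a thin slab of the single functional given by \<open>B j\<close> and
  \<open>v\<close>.\<close>

lemma cluster_unique:
  assumes p: "\<And>n. p \<in> closure (convex hull (x ` {n..}))"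
    and q: "\<And>n. q \<in> closure (convex hull (x ` {n..}))"
  shows "p = q"
proof (rule ccontr)
  assume "p \<noteq> q"
  define v where "v = q - p"
  \<comment> \<open>The slab will have width \<open>4 * e\<close>, whereas the lower bound on the
    metric separates \<open>p\<close> from \<open>q\<close> by \<open>8 * e\<close>.\<close>
  define e where "e = nu0 * (norm v)\<^sup>2 / 8"
  have e: "0 < e" using \<open>p \<noteq> q\<close> nv(1) by (simp add: e_def v_def)
  have below: "w \<in> D \<and> (\<forall>k. obj w \<le> obj (x k))" if "minimal w" for w
    using that x_D by (simp add: minimal_def)
  have conv: "convergent (\<lambda>k. B k (x k - w) (x k - w))"
    if "\<And>n. w \<in> closure (convex hull (x ` {n..}))" for w
    using below[OF cluster_minimal[OF that]] by (intro fejer) auto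
  \<comment> \<open>Expanding the squares cancels \<open>B k (x k) (x k)\<close>, the only term on
    the right whose convergence is not yet known.\<close>
  have eq: "B k (x k) v = 1 / 2 * (B k (x k - p) (x k - p) - B k (x k - q) (x k - q) - B k p p + B k q q)" for k
  proof -
    interpret B: bounded_bilinear "B k" by (rule B_bounded_bilinear)
    show ?thesis
      unfolding v_def using B_sym[of k p "x k"] B_sym[of k q "x k"]
      by (simp add: B.diff_left B.diff_right)
  qed
  have "convergent (\<lambda>k. 1 / 2 * (B k (x k - p) (x k - p) - B k (x k - q) (x k - q) - B k p p + B k q q))"
    by (intro convergent_mult convergent_const convergent_add convergent_diff conv p q B_convergent)
  then have "convergent (\<lambda>k. B k (x k) v)" by (simp only: eq)
  then obtain l where l: "(\<lambda>k. B k (x k) v) \<longlonglongrightarrow> l" unfolding convergent_def by blast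
  obtain R where R: "0 < R" "\<And>k. norm (x k) \<le> R"
    using bounded_x by (auto simp: bounded_pos)
  have "decseq (\<lambda>k. B k v v)" using B_decreasing by (simp add: decseq_Suc_iff)
  then obtain \<kappa> where \<kappa>: "(\<lambda>k. B k v v) \<longlonglongrightarrow> \<kappa>" "\<And>k. \<kappa> \<le> B k v v"
    using decseq_bounded_below_tendsto[of "\<lambda>k. B k v v" 0] B_nonneg by blast
  have pos: "0 < mu * R\<^sup>2" using mu R(1) by simp
  have "\<forall>\<^sub>F k in sequentially. B k v v < \<kappa> + e\<^sup>2 / (mu * R\<^sup>2)"
    using \<kappa>(1) e pos by (intro order_tendstoD(2)) auto
  \<comment> \<open>The excess of \<open>B j v v\<close> over its limit is chosen so that its
    product with the bound \<open>mu * R\<^sup>2\<close> for the iterates stays below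
    \<open>e\<^sup>2\<close>.\<close>
  then obtain j where j: "B j v v < \<kappa> + e\<^sup>2 / (mu * R\<^sup>2)"
    by (auto simp: eventually_sequentially)
  obtain K where K: "\<And>k. K \<le> k \<Longrightarrow> \<bar>B k (x k) v - l\<bar> < e"
    using LIMSEQ_D[OF l e] by auto
  interpret Bj: bounded_bilinear "B j" by (rule B_bounded_bilinear)
  have near: "\<bar>B j (x k) v - l\<bar> \<le> 2 * e" if k: "max j K \<le> k" for k
  proof -
    interpret Bk: bounded_bilinear "B k" by (rule B_bounded_bilinear)
    let ?E = "\<lambda>u w. B j u w - B k u w"
    have mono: "B k u u \<le> B j u u" for u
      using lift_Suc_antimono_le[of "\<lambda>k. B k u u" j k] B_decreasing k by simp
    have "(?E (x k) v)\<^sup>2 \<le> ?E (x k) (x k) * ?E v v"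
    proof (rule psd_cauchy_schwarz)
      show "bilinear ?E"
        unfolding bilinear_def linear_iff
        by (simp add: Bj.add_left Bk.add_left Bj.add_right Bk.add_right Bj.scaleR_left
            Bk.scaleR_left Bj.scaleR_right Bk.scaleR_right right_diff_distrib)
    qed (use B_sym mono in auto)
    also have "\<dots> \<le> (mu * R\<^sup>2) * (e\<^sup>2 / (mu * R\<^sup>2))"
    proof (rule mult_mono)
      have "B j (x k) (x k) \<le> mu * (norm (x k))\<^sup>2" by (rule B_upper)
      also have "\<dots> \<le> mu * R\<^sup>2" using mu R by (intro mult_left_mono power_mono) auto
      finally show "?E (x k) (x k) \<le> mu * R\<^sup>2" using B_nonneg[of k "x k"] by linarith
      show "?E v v \<le> e\<^sup>2 / (mu * R\<^sup>2)" using j \<kappa>(2)[of k] by linarith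
    qed (use pos mono in auto)
    also have "\<dots> = e\<^sup>2" using mu R(1) by simp
    finally have "\<bar>?E (x k) v\<bar> \<le> e"
      using e abs_le_square_iff[of "?E (x k) v" e] by simp
    moreover have "\<bar>B k (x k) v - l\<bar> < e" using K k by simp
    ultimately show ?thesis by linarith
  qed
  let ?H = "{u. l - 2 * e \<le> B j u v} \<inter> {u. B j u v \<le> l + 2 * e}"
  have "closure (convex hull (x ` {max j K..})) \<subseteq> ?H"
  proof (rule closure_convex_hull_subset)
    show "x ` {max j K..} \<subseteq> ?H"
    proof
      fix u assume "u \<in> x ` {max j K..}"
      then obtain k where "max j K \<le> k" "u = x k" by auto
      then have "\<bar>B j u v - l\<bar> \<le> 2 * e" using near by simp
      then have "l - 2 * e \<le> B j u v" "B j u v \<le> l + 2 * e" by linarith+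
      then show "u \<in> ?H" by simp
    qed
    show "closed ?H"
      by (intro closed_Int closed_Collect_le continuous_intros Bj.continuous_on)
    have lin: "linear (\<lambda>u. B j u v)"
      using scalar_product[of j] by (simp add: is_scalar_product_def bilinear_def)
    have "convex ((\<lambda>u. B j u v) -` {l - 2 * e..l + 2 * e})"
      by (intro convex_linear_vimage lin) simp
    moreover have "(\<lambda>u. B j u v) -` {l - 2 * e..l + 2 * e} = ?H" by auto
    ultimately show "convex ?H" by simp
  qed
  then have "p \<in> ?H" "q \<in> ?H" using p q by blast+
  then have "B j v v \<le> 4 * e" by (simp add: v_def Bj.diff_left)
  then show False using B_lower0[of v j] e by (simp add: e_def)
qed

lemma x_weakly_converges: "\<exists>p. minimal p \<and> weakly_converges x p"
  using weakly_converges_if_unique_cluster[OF bounded_x cluster_unique] cluster_minimal by blast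

lemma d_tendsto: "d \<longlonglongrightarrow> 0"
proof -
  have "(\<lambda>k. (norm (d k))\<^sup>2) \<longlonglongrightarrow> 0"
    using summable_LIMSEQ_zero summable_steps(1)[OF minimal_below] by blast
  then have "(\<lambda>k. sqrt ((norm (d k))\<^sup>2)) \<longlonglongrightarrow> sqrt 0" by (rule tendsto_real_sqrt)
  then show ?thesis by (simp add: tendsto_norm_zero_iff)
qed

lemma y_weakly_converges:
  assumes "weakly_converges x p"
  shows "weakly_converges y p"
  unfolding weakly_converges_def
proof
  fix z
  have "(\<lambda>k. inner (x k) z) \<longlonglongrightarrow> inner p z"
    using assms by (simp add: weakly_converges_def)
  moreover have "(\<lambda>k. inner (d k) z) \<longlonglongrightarrow> inner 0 z"
    by (intro tendsto_inner d_tendsto tendsto_const)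
  ultimately have "(\<lambda>k. inner (x k) z + inner (d k) z) \<longlonglongrightarrow> inner p z + inner 0 z"
    by (rule tendsto_add)
  then show "(\<lambda>k. inner (y k) z) \<longlonglongrightarrow> inner p z"
    by (simp add: d_def flip: inner_add_left)
qed

lemma obj_x_tendsto: "(\<lambda>k. obj (x k)) \<longlonglongrightarrow> obj s"
  using s by (intro obj_tendsto minimal_below) (simp add: minimal_def)

text \<open>The unrelaxed step may increase the objective, but by at most
  \<open>L / 2 * (norm (d k))\<^sup>2\<close>: the proximal gain is nonnegative, so only the
  curvature term survives, and it vanishes in the limit.\<close>

lemma obj_y_tendsto: "(\<lambda>k. obj (y k)) \<longlonglongrightarrow> obj s"
proof (rule tendsto_sandwich)
  show "\<forall>\<^sub>F k in sequentially. obj s \<le> obj (y k)"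
    using s y_D by (simp add: minimal_def)
  show "\<forall>\<^sub>F k in sequentially. obj (y k) \<le> obj (x k) + L / 2 * (norm (d k))\<^sup>2"
  proof (intro always_eventually allI)
    fix k
    have "0 \<le> \<gamma> k * (G (x k) - G (y k) - inner (d k) (grad (x k)))"
      by (rule order_trans[OF B_nonneg y_decrease])
    then have "0 \<le> G (x k) - G (y k) - inner (d k) (grad (x k))"
      using \<gamma>_pos[of k] by (simp add: zero_le_mult_iff)
    then show "obj (y k) \<le> obj (x k) + L / 2 * (norm (d k))\<^sup>2"
      using F_descent[OF x_D y_D, of k k] by (simp add: obj_def d_def)
  qed
  have "(\<lambda>k. obj (x k) + L / 2 * (norm (d k))\<^sup>2) \<longlonglongrightarrow> obj s + L / 2 * (norm (0::'a))\<^sup>2"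
    by (intro tendsto_intros obj_x_tendsto d_tendsto)
  then show "(\<lambda>k. obj (x k) + L / 2 * (norm (d k))\<^sup>2) \<longlonglongrightarrow> obj s" by simp
qed simp

lemma obj_rate: "(\<lambda>k. obj (x k) - obj s) \<in> o(\<lambda>k. 1 / real k)"
proof (rule summable_decseq_smallo)
  show "decseq (\<lambda>k. obj (x k) - obj s)" using decseq_obj by (simp add: decseq_def)
  show "summable (\<lambda>k. obj (x k) - obj s)"
    using s by (intro fejer(2) minimal_below) (simp add: minimal_def)
qed (use minimal_below in simp)

end

end

section \<open>Metrics, gradients and proximal steps\<close>

text \<open>Discharges the definite description: Riesz representation of
  \<open>\<lambda>d. B d v\<close> in the original scalar product provides the operator, and testing
  against all vectors shows that it is unique.\<close>

lemma associated_operator_inner: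
  fixes B :: "'a::{real_inner,complete_space} \<Rightarrow> 'a \<Rightarrow> real"
  assumes sp: "is_scalar_product B" and up: "\<And>x. B x x \<le> \<mu> * (norm x)\<^sup>2"
  shows "inner x (associated_operator B y) = B x y"
proof -
  interpret B: bounded_bilinear B
    by (rule scalar_product_bounded_bilinear[OF sp up])
  have inner: "is_scalar_product (inner :: 'a \<Rightarrow> _)"
    by (auto simp: is_scalar_product_def bilinear_def linear_iff inner_add_left inner_add_right inner_commute)
  have "\<exists>u. \<forall>d. inner d u = B d v" for v
    by (rule scalar_product_riesz[OF inner, of 1 1]) (auto simp: power2_norm_eq_inner B.bounded_linear_left)
  then obtain W where W: "\<And>d v. inner d (W v) = B d v"
    by metis
  have "associated_operator B = W"
    unfolding associated_operator_def
  proof (rule the_equality)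
    fix V assume "\<forall>x y. B x y = inner x (V y)"
    then have "inner x (V y) = inner x (W y)" for x y using W by metis
    then show "V = W" by (intro ext) (metis vector_eq_ldot)
  qed (simp add: W)
  then show ?thesis by (simp add: W)
qed

text \<open>Riesz representation in the metric \<open>B\<close> plays the role of the inverse
  operator: the vector representing \<open>\<lambda>d. inner d u\<close> satisfies the defining
  limits of the gradient, and positive definiteness excludes any other.\<close>

lemma gateaux_gradient_scalar_product:
  fixes B :: "'a::{real_inner,complete_space} \<Rightarrow> 'a \<Rightarrow> real"
  assumes sp: "is_scalar_product B"
    and bounds: "0 < \<nu>" "\<And>x. \<nu> * (norm x)\<^sup>2 \<le> B x x" "\<And>x. B x x \<le> \<mu> * (norm x)\<^sup>2"
    and u: "has_gateaux_gradient inner f x u"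
  shows "B d (gateaux_gradient B f x) = inner d u"
proof -
  have "\<exists>v. \<forall>d. B d v = inner d u"
    by (rule scalar_product_riesz[OF sp bounds bounded_linear_inner_left])
  then obtain v where v: "\<forall>d. B d v = inner d u" ..
  then have grad: "has_gateaux_gradient B f x v"
    using u by (simp add: has_gateaux_gradient_def)
  have "gateaux_gradient B f x = v"
    unfolding gateaux_gradient_def
  proof (rule the_equality)
    show "has_gateaux_gradient B f x v" by (rule grad)
    fix w assume w: "has_gateaux_gradient B f x w"
    have eq: "B d w = B d v" for d
    proof -
      have "((\<lambda>t. (f (x + t *\<^sub>R d) - f x) / ereal t) \<longlongrightarrow> ereal (B d w)) (at 0)"
        "((\<lambda>t. (f (x + t *\<^sub>R d) - f x) / ereal t) \<longlongrightarrow> ereal (B d v)) (at 0)"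
        using w grad by (simp_all add: has_gateaux_gradient_def)
      then have "ereal (B d w) = ereal (B d v)"
        by (intro tendsto_unique[of "at (0::real)"]) auto
      then show ?thesis by simp
    qed
    have bil: "bilinear B" using sp by (simp add: is_scalar_product_def)
    have "B (w - v) (w - v) = 0" using eq[of "w - v"] by (simp add: bilinear_rsub[OF bil])
    moreover have "w - v \<noteq> 0 \<Longrightarrow> 0 < B (w - v) (w - v)"
      using sp by (simp add: is_scalar_product_def)
    ultimately show "w = v" by fastforce
  qed
  then show ?thesis using v by simp
qed

lemma scaled_function:
  fixes g :: "'a::real_normed_vector \<Rightarrow> ereal"
  assumes g: "proper_fun g" "convex_fun g" "lsc_fun g" and c: "0 < c"
  shows "effective_domain (\<lambda>z. ereal c * g z) = effective_domain g"
    and "proper_fun (\<lambda>z. ereal c * g z)"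
    and "convex_fun (\<lambda>z. ereal c * g z)"
    and "lsc_fun (\<lambda>z. ereal c * g z)"
proof -
  have ninf: "g z \<noteq> - \<infinity>" for z using g(1) by (simp add: proper_fun_def)
  have "ereal c * g z < \<infinity> \<longleftrightarrow> g z < \<infinity>" for z using c by (cases "g z") auto
  then show dom: "effective_domain (\<lambda>z. ereal c * g z) = effective_domain g"
    by (simp add: effective_domain_def)
  have "ereal c * g z \<noteq> - \<infinity>" for z using c ninf[of z] by (cases "g z") auto
  then show "proper_fun (\<lambda>z. ereal c * g z)"
    using g(1) unfolding proper_fun_def dom by blast
  show "convex_fun (\<lambda>z. ereal c * g z)"
    unfolding convex_fun_def
  proof (intro allI impI)
    fix x y and t :: real assume t: "0 < t \<and> t < 1"
    have "ereal c * g ((1 - t) *\<^sub>R x + t *\<^sub>R y) \<le> ereal c * (ereal (1 - t) * g x + ereal t * g y)"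
      using g(2) t c unfolding convex_fun_def by (intro ereal_mult_left_mono) auto
    also have "\<dots> = ereal (1 - t) * (ereal c * g x) + ereal t * (ereal c * g y)"
      using t c ninf[of x] ninf[of y] by (cases "g x"; cases "g y") (auto simp: algebra_simps)
    finally show "ereal c * g ((1 - t) *\<^sub>R x + t *\<^sub>R y) \<le> \<dots>" .
  qed
  have "b < ereal c * g z \<longleftrightarrow> b / ereal c < g z" for b z
    using c by (simp add: ereal_divide_less_pos)
  then show "lsc_fun (\<lambda>z. ereal c * g z)"
    using g(3) unfolding lsc_fun_iff by simp
qed

text \<open>The product of \<open>B\<close> with its own gradient is a product in the original
  scalar product, so the metric survives only in \<open>B (z - y) (x - y)\<close>. The inequality is
  thus homogeneous in the pair of metric and step, as the rescaling requires.\<close>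

lemma prox_step:
  fixes f g :: "'a::{real_inner,complete_space} \<Rightarrow> ereal"
  assumes sp: "is_scalar_product B"
    and bounds: "0 < \<nu>" "\<And>x. \<nu> * (norm x)\<^sup>2 \<le> B x x" "\<And>x. B x x \<le> \<mu> * (norm x)\<^sup>2"
    and g: "proper_fun g" "convex_fun g" "lsc_fun g" and c: "0 < c"
    and y: "y = prox B (\<lambda>z. ereal c * g z) (x - c *\<^sub>R gateaux_gradient B f x)"
  shows "y \<in> effective_domain g"
    and "has_gateaux_gradient inner f x u \<Longrightarrow> z \<in> effective_domain g \<Longrightarrow>
      B (z - y) (x - y) \<le> c * (real_of_ereal (g z) - real_of_ereal (g y) + inner (z - y) u)"
proof -
  interpret B: bounded_bilinear B
    by (rule scalar_product_bounded_bilinear[OF sp bounds(3)])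
  let ?h = "\<lambda>z. ereal c * g z"
  let ?v = "gateaux_gradient B f x"
  let ?\<psi> = "\<lambda>z. ?h z + ereal (1 / 2 * (induced_norm B (z - (x - c *\<^sub>R ?v)))\<^sup>2)"
  note h = scaled_function[OF g c]
  have "\<exists>p. \<forall>z. ?\<psi> p \<le> ?\<psi> z"
    by (rule prox_exists[OF sp bounds h(2-4)])
  then have "\<exists>p. is_arg_min ?\<psi> (\<lambda>_. True) p"
    by (simp add: is_arg_min_def not_less)
  \<comment> \<open>\<open>arg_min\<close> selects by a choice operator, so the existence of a
    minimiser already makes \<open>y\<close> one.\<close>
  then have "is_arg_min ?\<psi> (\<lambda>_. True) y"
    unfolding y prox_def arg_min_def by (rule someI_ex)
  then have min: "?\<psi> y \<le> ?\<psi> z" for z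
    by (simp add: is_arg_min_def not_less)
  show "y \<in> effective_domain g"
    using prox_variational_inequality(1)[OF sp h(2,3) min] by (simp add: h(1))
  assume u: "has_gateaux_gradient inner f x u" and z: "z \<in> effective_domain g"
  have "B (z - y) (x - c *\<^sub>R ?v - y) \<le> real_of_ereal (?h z) - real_of_ereal (?h y)"
    using prox_variational_inequality(2)[OF sp h(2,3) min] z by (simp add: h(1))
  moreover have "B (z - y) (x - c *\<^sub>R ?v - y) = B (z - y) (x - y) - c * inner (z - y) u"
  proof -
    have "x - c *\<^sub>R ?v - y = (x - y) - c *\<^sub>R ?v" by simp
    then show ?thesis
      using gateaux_gradient_scalar_product[OF sp bounds u, of "z - y"]
      by (simp only: B.diff_right[of _ "x - y"] B.scaleR_right real_scaleR_def)
  qed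
  ultimately show "B (z - y) (x - y) \<le> c * (real_of_ereal (g z) - real_of_ereal (g y) + inner (z - y) u)"
    by (simp add: algebra_simps)
qed

text \<open>On the unit sphere the extrema bound the form directly, and homogeneity extends the
  bounds to all vectors. The sphere has to be nonempty, since the real infimum of the empty set
  carries no information.\<close>

lemma sphere_form_bounds:
  fixes B :: "'a::{real_inner,complete_space} \<Rightarrow> 'a \<Rightarrow> real"
  assumes sp: "is_scalar_product B" and sphere: "\<exists>z::'a. norm z = 1"
    and bounds: "\<And>x. \<nu> * (norm x)\<^sup>2 \<le> B x x" "\<And>x. B x x \<le> \<mu> * (norm x)\<^sup>2"
    and a: "a = (INF z\<in>{z. norm z = 1}. inner z (associated_operator B z))"
    and b: "b = (SUP z\<in>{z. norm z = 1}. inner z (associated_operator B z))"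
  shows "\<nu> \<le> a" "a \<le> \<mu>" "a * (norm z)\<^sup>2 \<le> B z z" "B z z \<le> b * (norm z)\<^sup>2"
proof -
  have W: "inner z (associated_operator B z) = B z z" for z
    by (rule associated_operator_inner[OF sp bounds(2)])
  let ?S = "{z::'a. norm z = 1}"
  have in_bounds: "\<nu> \<le> B z z \<and> B z z \<le> \<mu>" if "z \<in> ?S" for z
    using bounds[of z] that by simp
  have a': "a = (INF z\<in>?S. B z z)" and b': "b = (SUP z\<in>?S. B z z)"
    unfolding a b W by simp_all
  have bdd: "bdd_below ((\<lambda>z. B z z) ` ?S)" "bdd_above ((\<lambda>z. B z z) ` ?S)"
    using in_bounds by (intro bdd_belowI2[of _ \<nu>] bdd_aboveI2[of _ _ \<mu>]; blast)+
  have a_le: "a \<le> B z z" and b_ge: "B z z \<le> b" if "z \<in> ?S" for z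
    unfolding a' b' using that bdd by (auto intro: cINF_lower cSUP_upper)
  show "\<nu> \<le> a"
    unfolding a' using sphere in_bounds by (intro cINF_greatest) auto
  show "a \<le> \<mu>"
    using sphere a_le in_bounds order_trans by blast
  have scale: "B z z = (norm z)\<^sup>2 * B (z /\<^sub>R norm z) (z /\<^sub>R norm z)" if "z \<noteq> 0"
  proof -
    have bil: "bilinear B" using sp by (simp add: is_scalar_product_def)
    show ?thesis
      using that by (simp add: bilinear_lmul[OF bil] bilinear_rmul[OF bil] power2_eq_square field_simps)
  qed
  have zero: "B 0 0 = 0"
    using sp by (simp add: is_scalar_product_def bilinear_lzero)
  show "a * (norm z)\<^sup>2 \<le> B z z"
  proof (cases "z = 0")
    case False
    then show ?thesis
      using a_le[of "z /\<^sub>R norm z"] scale[OF False] by (simp add: mult.commute mult_left_mono)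
  qed (simp add: zero)
  show "B z z \<le> b * (norm z)\<^sup>2"
  proof (cases "z = 0")
    case False
    then show ?thesis
      using b_ge[of "z /\<^sub>R norm z"] scale[OF False] by (simp add: mult.commute mult_left_mono)
  qed (simp add: zero)
qed

text \<open>In the second case the normalised forms \<open>q k / a k\<close> satisfy the first one with
  \<open>\<eta> k = (b (k + 1) - a (k + 1)) / a (k + 1)\<close>.\<close>

lemma metric_rescaling:
  fixes q :: "nat \<Rightarrow> 'a::real_normed_vector \<Rightarrow> real" and a b :: "nat \<Rightarrow> real"
  assumes a: "0 < \<nu>" "\<And>k. \<nu> \<le> a k" "\<And>k. a k \<le> \<mu>" "\<And>k. a k \<le> b k"
    and q: "\<And>k z. a k * (norm z)\<^sup>2 \<le> q k z" "\<And>k z. q k z \<le> b k * (norm z)\<^sup>2"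
    and metrics: "(\<exists>\<eta>::nat \<Rightarrow> real. (\<forall>k. 0 \<le> \<eta> k) \<and> summable \<eta> \<and> (\<forall>k z. q (Suc k) z \<le> (1 + \<eta> k) * q k z))
      \<or> summable (\<lambda>k. b k - a k)"
  shows "\<exists>s s0 s1. 0 < s0 \<and> (\<forall>k. s0 \<le> s k \<and> s k \<le> s1) \<and> (\<forall>k z. s (Suc k) * q (Suc k) z \<le> s k * q k z)"
  using metrics
proof
  have a_pos: "0 < a k" for k using a(1,2) less_le_trans by blast
  have q_nonneg: "0 \<le> q k z" for k z
    using a_pos[of k] by (intro order_trans[OF _ q(1)]) simp
  {
    assume "\<exists>\<eta>::nat \<Rightarrow> real. (\<forall>k. 0 \<le> \<eta> k) \<and> summable \<eta> \<and> (\<forall>k z. q (Suc k) z \<le> (1 + \<eta> k) * q k z)"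
    then obtain \<eta> :: "nat \<Rightarrow> real" where \<eta>: "\<And>k. 0 \<le> \<eta> k" "summable \<eta>"
        "\<And>k z. q (Suc k) z \<le> (1 + \<eta> k) * q k z" by blast
    show ?thesis
      using decreasing_rescaling[of \<eta> q, OF \<eta> q_nonneg] by blast
  next
    assume sum: "summable (\<lambda>k. b k - a k)"
    define \<eta> where "\<eta> = (\<lambda>k. (b (Suc k) - a (Suc k)) / a (Suc k))"
    have \<eta>: "0 \<le> \<eta> k" for k using a(4) a_pos[of "Suc k"] by (simp add: \<eta>_def)
    have "summable \<eta>"
    proof (rule summable_comparison_test')
      show "summable (\<lambda>k. (b (Suc k) - a (Suc k)) / \<nu>)"
        using sum by (intro summable_divide) (simp add: summable_Suc_iff[of "\<lambda>k. b k - a k"])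
      show "norm (\<eta> k) \<le> (b (Suc k) - a (Suc k)) / \<nu>" if "0 \<le> k" for k
        using \<eta>[of k] a a_pos[of "Suc k"] unfolding \<eta>_def by (auto intro: divide_left_mono)
    qed
    have step: "q (Suc k) z / a (Suc k) \<le> (1 + \<eta> k) * (q k z / a k)" for k z
    proof -
      have "q (Suc k) z / a (Suc k) \<le> b (Suc k) * (norm z)\<^sup>2 / a (Suc k)"
        using q(2) a_pos[of "Suc k"] by (simp add: divide_right_mono)
      also have "\<dots> = (1 + \<eta> k) * (norm z)\<^sup>2"
        using a_pos[of "Suc k"] by (simp add: \<eta>_def field_simps)
      also have "\<dots> \<le> (1 + \<eta> k) * (q k z / a k)"
        using \<eta>[of k] q(1)[of k z] a_pos[of k]
        by (intro mult_left_mono) (auto simp: pos_le_divide_eq mult.commute)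
      finally show ?thesis .
    qed
    have "0 \<le> q k z / a k" for k z using q_nonneg a_pos[of k] by simp
    from decreasing_rescaling[of \<eta> "\<lambda>k z. q k z / a k", OF \<eta> \<open>summable \<eta>\<close> step this]
    obtain s c where s: "0 < c" "\<forall>k. c \<le> s k \<and> s k \<le> 1"
        "\<forall>k z. s (Suc k) * (q (Suc k) z / a (Suc k)) \<le> s k * (q k z / a k)" by blast
    have s_nonneg: "0 \<le> s k" for k using s(1) s(2)[rule_format, of k] by linarith
    have "0 < \<mu>" using a_pos[of 0] a(3)[of 0] by linarith
    show ?thesis
    \<comment> \<open>The factors \<open>s k\<close> belong to the normalised forms. Dividing by
      \<open>a k\<close>, which lies between \<open>\<nu>\<close> and \<open>\<mu>\<close>,
      transfers them to \<open>q k\<close> and produces the two bounds.\<close>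
    proof (rule exI[of _ "\<lambda>k. s k / a k"], rule exI[of _ "c / \<mu>"], rule exI[of _ "1 / \<nu>"], intro conjI allI)
      show "0 < c / \<mu>" using s(1) \<open>0 < \<mu>\<close> by simp
      show "c / \<mu> \<le> s k / a k" for k
        using s(1,2) a(3) a_pos[of k] s_nonneg by (intro frac_le) auto
      show "s k / a k \<le> 1 / \<nu>" for k
        using s(2) a s_nonneg by (intro frac_le) auto
      show "s (Suc k) / a (Suc k) * q (Suc k) z \<le> s k / a k * q k z" for k z
        using s(3) by simp
    qed
  }
qed

text \<open>The supremum itself serves as \<open>c\<close>: lying strictly below the bound it is
  finite, even if \<open>L = 0\<close> makes the bound infinite, and positivity of
  \<open>r 0\<close> makes it positive.\<close>

lemma step_constant:
  fixes r :: "nat \<Rightarrow> real"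
  assumes "(SUP k. ereal (r k)) < (if L = 0 then \<infinity> else ereal (2 / L))" "0 \<le> L" "0 < r 0"
  shows "\<exists>c>0. c * L < 2 \<and> (\<forall>k. r k \<le> c)"
proof -
  define s where "s = (SUP k. ereal (r k))"
  have le: "ereal (r k) \<le> s" for k unfolding s_def by (intro SUP_upper) simp
  have "s < \<infinity>" using assms(1) unfolding s_def by (cases "L = 0") (auto intro: less_trans)
  then obtain c where c: "s = ereal c" using le[of 0] by (cases s) auto
  have "c * L < 2"
    using assms(1,2) c unfolding s_def[symmetric] by (cases "L = 0") (auto simp: field_simps)
  moreover have "r k \<le> c" for k using le[of k] c by simp
  ultimately show ?thesis using assms(3) less_le_trans by blast
qed

theorem theorem3p22:
  fixes f g :: "'a::{real_inner, complete_space} \<Rightarrow> ereal"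
    and L \<nu> \<mu> :: real
    and ip :: "nat \<Rightarrow> 'a \<Rightarrow> 'a \<Rightarrow> real"
    and W :: "nat \<Rightarrow> 'a \<Rightarrow> 'a"
    and nu_seq mu_seq \<gamma> lam :: "nat \<Rightarrow> real"
    and x y :: "nat \<Rightarrow> 'a"
    and S :: "'a set"
  assumes f: "proper_fun f" "convex_fun f" "lsc_fun f"
    and g: "proper_fun g" "convex_fun g" "lsc_fun g"
    and dom: "effective_domain g \<subseteq> effective_domain f"
    and diff: "\<forall>z\<in>effective_domain g. gateaux_differentiable f z"
    and lip: "0 \<le> L" "lipschitz_on L (effective_domain g) (gateaux_gradient inner f)"
    and ip: "\<forall>k. is_scalar_product (ip k)"
    and W: "\<forall>k. W k = associated_operator (ip k)"
    and bounds: "0 < \<nu>" "\<nu> \<le> \<mu>"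
      "\<forall>k z. \<nu> * (norm z)\<^sup>2 \<le> (induced_norm (ip k) z)\<^sup>2 \<and>
             (induced_norm (ip k) z)\<^sup>2 \<le> \<mu> * (norm z)\<^sup>2"
    and nu_seq: "\<forall>k. nu_seq k = (INF z\<in>{z. norm z = 1}. inner z (W k z))"
    and mu_seq: "\<forall>k. mu_seq k = (SUP z\<in>{z. norm z = 1}. inner z (W k z))"
    and metrics:
      "(\<exists>\<eta>::nat \<Rightarrow> real. (\<forall>k. 0 \<le> \<eta> k) \<and> summable \<eta> \<and>
          (\<forall>k z. (induced_norm (ip (Suc k)) z)\<^sup>2 \<le> (1 + \<eta> k) * (induced_norm (ip k) z)\<^sup>2))
       \<or> summable (\<lambda>k. mu_seq k - nu_seq k)"
    and gamma: "\<forall>k. 0 < \<gamma> k" "0 < (INF k. \<gamma> k)"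
    and lambda: "\<forall>k. 0 < lam k \<and> lam k \<le> 1" "0 < (INF k. lam k)"
    and step: "(SUP k. ereal (\<gamma> k * lam k / nu_seq k)) < (if L = 0 then \<infinity> else ereal (2 / L))"
    and x0: "x 0 \<in> effective_domain g"
    and y: "\<forall>k. y k = prox (ip k) (\<lambda>z. ereal (\<gamma> k) * g z)
                        (x k - \<gamma> k *\<^sub>R gateaux_gradient (ip k) f (x k))"
    and x: "\<forall>k. x (Suc k) = x k + lam k *\<^sub>R (y k - x k)"
    and S: "S = argmin_set (\<lambda>z. f z + g z)"
  shows
    "decseq (\<lambda>k. f (x k) + g (x k))
     \<and> ((INF k. f (x k) + g (x k)) > -\<infinity> \<longrightarrow> summable (\<lambda>k. (norm (x (Suc k) - x k))\<^sup>2))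
     \<and> (S \<noteq> {} \<longrightarrow>
          (\<exists>p\<in>S. weakly_converges x p \<and> weakly_converges y p)
        \<and> (\<lambda>k. f (y k) + g (y k)) \<longlonglongrightarrow> (INF z. f z + g z)
        \<and> ((\<Sum>k. ereal (\<gamma> k * lam k)) = \<infinity> \<longrightarrow>
             (\<lambda>k. f (x k) + g (x k)) \<longlonglongrightarrow> (INF z. f z + g z))
        \<and> (0 < (INF k. \<gamma> k * lam k) \<longrightarrow>
             (\<lambda>k. real_of_ereal (f (x k) + g (x k) - (INF z. f z + g z))) \<in> o(\<lambda>k. 1 / real k)))
     \<and> (S = {} \<longrightarrow>
          filterlim (\<lambda>k. norm (x k)) at_top sequentially
        \<and> (\<lambda>k. f (x k) + g (x k)) \<longlonglongrightarrow> (INF z. f z + g z))"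
proof (cases "\<exists>z::'a. norm z = 1")
  \<comment> \<open>An empty unit sphere means that the space is trivial. All sequences are then
    constantly 0, and \<open>nu_seq\<close> and \<open>mu_seq\<close> are not consulted.\<close>
  case False
  have triv: "z = 0" for z :: 'a
  proof (rule ccontr)
    assume "z \<noteq> 0"
    then have "norm (z /\<^sub>R norm z) = 1" by simp
    then show False using False by blast
  qed
  have xy: "x = (\<lambda>_. 0)" "y = (\<lambda>_. 0)" by (intro ext triv)+
  have UNIV: "(UNIV :: 'a set) = {0}" using triv by auto
  have "0 \<in> effective_domain g" using x0 triv[of "x 0"] by simp
  then obtain a b where ab: "f 0 = ereal a" "g 0 = ereal b"
    using dom ereal_real_effective_domain[OF f(1)] ereal_real_effective_domain[OF g(1)] by blast
  have "\<not> f w + g w < f 0 + g 0" for w using triv[of w] by simp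
  then have "0 \<in> S" by (simp add: S argmin_set_def is_arg_min_def)
  then have S0: "S = {0}" using UNIV by (metis UNIV_I singletonD subset_singletonD empty_iff subsetI)
  show ?thesis
    unfolding S0 xy UNIV by (simp add: ab decseq_def weakly_converges_def)
next
  case True
  define D where "D = effective_domain g"
  define F where "F = (\<lambda>z. real_of_ereal (f z))"
  define G where "G = (\<lambda>z. real_of_ereal (g z))"
  define grad where "grad = gateaux_gradient inner f"
  have sp: "is_scalar_product (ip k)" for k using ip by blast
  have low: "\<nu> * (norm z)\<^sup>2 \<le> ip k z z" and up: "ip k z z \<le> \<mu> * (norm z)\<^sup>2" for k z
    using bounds(3) induced_norm_square[OF sp] by simp_all
  have \<mu>: "0 < \<mu>" using bounds by linarith
  have nu_def: "nu_seq k = (INF z\<in>{z. norm z = 1}. inner z (associated_operator (ip k) z))"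
    and mu_def: "mu_seq k = (SUP z\<in>{z. norm z = 1}. inner z (associated_operator (ip k) z))" for k
    using nu_seq mu_seq W by simp_all
  note form = sphere_form_bounds[OF sp True low up nu_def mu_def]
  have nu_pos: "0 < nu_seq k" for k using form(1)[of k] bounds(1) by linarith
  have nu_le_mu: "nu_seq k \<le> mu_seq k" for k
  proof -
    obtain z :: 'a where "norm z = 1" using True by blast
    then show ?thesis using form(3,4)[of k z] by simp
  qed
  have "\<exists>s s0 s1. 0 < s0 \<and> (\<forall>k. s0 \<le> s k \<and> s k \<le> s1) \<and> (\<forall>k z. s (Suc k) * ip (Suc k) z z \<le> s k * ip k z z)"
    using metrics unfolding induced_norm_square[OF sp]
    by (rule metric_rescaling[OF bounds(1) form(1,2) nu_le_mu form(3,4)])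
  then obtain s s0 s1 where s: "0 < s0" "\<And>k. s0 \<le> s k" "\<And>k. s k \<le> s1"
      "\<And>k z. s (Suc k) * ip (Suc k) z z \<le> s k * ip k z z"
    by blast
  have s_pos: "0 < s k" for k using s(1,2) less_le_trans by blast
  have s1: "0 < s1" using s_pos[of 0] s(3)[of 0] by linarith
  have \<gamma>_pos: "0 < \<gamma> k" and lam: "0 < lam k" "lam k \<le> 1" for k
    using gamma lambda by auto
  define l0 where "l0 = (INF k. lam k)"
  define c0 where "c0 = (INF k. \<gamma> k)"
  have l0: "0 < l0" "l0 \<le> lam k" for k
  proof -
    show "0 < l0" using lambda(2) by (simp add: l0_def)
    show "l0 \<le> lam k"
      unfolding l0_def
      by (rule cINF_lower, rule bdd_belowI2, rule less_imp_le, rule lam(1), rule UNIV_I)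
  qed
  have c0: "0 < c0" "c0 \<le> \<gamma> k" for k
  proof -
    show "0 < c0" using gamma(2) by (simp add: c0_def)
    show "c0 \<le> \<gamma> k"
      unfolding c0_def
      by (rule cINF_lower, rule bdd_belowI2, rule less_imp_le, rule \<gamma>_pos, rule UNIV_I)
  qed
  have "\<exists>c>0. c * L < 2 \<and> (\<forall>k. \<gamma> k * lam k / nu_seq k \<le> c)"
    by (rule step_constant[OF step lip(1)]) (simp add: \<gamma>_pos lam nu_pos)
  then obtain c where c: "0 < c" "c * L < 2" "\<And>k. \<gamma> k * lam k / nu_seq k \<le> c"
    by blast
  have c': "\<gamma> k * lam k \<le> c * nu_seq k" for k
    using c(3)[of k] nu_pos[of k] by (simp add: pos_divide_le_eq)
  \<comment> \<open>An upper bound on the steps comes from the step condition, from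
    \<open>nu_seq k \<le> \<mu>\<close> and from the lower bound on the relaxation
    parameters.\<close>
  have \<gamma>_le: "\<gamma> k \<le> c * \<mu> / l0" for k
  proof -
    have "\<gamma> k * l0 \<le> \<gamma> k * lam k" using l0 \<gamma>_pos[of k] by simp
    also have "\<dots> \<le> c * \<mu>"
      using c' form(2)[of k] c(1) by (meson less_imp_le mult_left_mono order_trans)
    finally show ?thesis using l0(1) by (simp add: pos_le_divide_eq)
  qed
  have y_D: "y k \<in> D" for k
    unfolding D_def by (rule prox_step(1)[OF sp bounds(1) low up g \<gamma>_pos y[rule_format]])
  have conv: "convex D" "convex_on D G" "convex_on (effective_domain f) F"
    unfolding D_def F_def G_def by (rule convex_effective_domain f g)+
  have x_D: "x k \<in> D" for k
  proof (induction k)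
    case (Suc k)
    have "x (Suc k) = (1 - lam k) *\<^sub>R x k + lam k *\<^sub>R y k"
      using x by (simp add: algebra_simps)
    then show ?case
      using convexD_alt[OF conv(1) Suc y_D, of "lam k"] lam[of k] by simp
  qed (use x0 D_def in simp)
  have DF: "D \<subseteq> effective_domain f" using dom by (simp add: D_def)
  have grad: "has_gateaux_gradient inner f z (grad z)" if "z \<in> D" for z
  proof -
    from bspec[OF diff that[unfolded D_def]] obtain u where u: "has_gateaux_gradient inner f z u"
      unfolding gateaux_differentiable_def ..
    show ?thesis
      unfolding grad_def gateaux_gradient_def
      by (rule theI[of _ u], rule u, rule has_gateaux_gradient_inner_unique[OF _ u])
  qed
  have fg: "f z + g z = ereal (F z + G z)" if "z \<in> D" for z
    using that DF ereal_real_effective_domain[OF f(1), of z] ereal_real_effective_domain[OF g(1), of z]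
    unfolding F_def G_def D_def by (metis plus_ereal.simps(1) subsetD)
  have fg_top: "f z + g z = \<infinity>" if "z \<notin> D" for z
    using that f(1) by (simp add: D_def effective_domain_def proper_fun_def)
  have sublevel: "{z \<in> D. F z + G z \<le> r} = {z. f z + g z \<le> ereal r}" for r
  proof (rule Collect_cong)
    fix z
    show "z \<in> D \<and> F z + G z \<le> r \<longleftrightarrow> f z + g z \<le> ereal r"
    proof (cases "z \<in> D")
      case True
      then show ?thesis by (simp only: fg ereal_less_eq(3) simp_thms)
    next
      case False
      show ?thesis unfolding fg_top[OF False] using False by simp
    qed
  qed
  have diffD: "\<forall>z\<in>D. gateaux_differentiable f z" using diff by (simp add: D_def)
  have lipD: "lipschitz_on L D (gateaux_gradient inner f)" using lip(2) by (simp add: D_def)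
  \<comment> \<open>Metric, lower form bound and step size all carry the factor \<open>s k\<close>,
    so the same iterates and the same ratio bound \<open>c\<close> fit the rescaled data. The
    uniform constants combine the bounds on \<open>s\<close> with those of the original
    data.\<close>
  interpret it: forward_backward D F G grad "\<lambda>k u v. s k * ip k u v" "\<lambda>k. s k * nu_seq k"
    "\<lambda>k. s k * \<gamma> k" lam x y L "s0 * \<nu>" "s1 * \<mu>" "s0 * c0" "s1 * (c * \<mu> / l0)" l0 c
  proof
    show "convex_on D F" using convex_on_subset[OF conv(3) DF conv(1)] .
    show "convex_on D G" by (rule conv(2))
    show "closed {z \<in> D. F z + G z \<le> r}" for r
      unfolding sublevel using f g
      by (intro lsc_fun_closed_sublevel lsc_fun_add) (auto simp: proper_fun_def)
    show "F z + inner (w - z) (grad z) \<le> F w"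
      "F w \<le> F z + inner (w - z) (grad z) + L / 2 * (norm (w - z))\<^sup>2"
      if "z \<in> D" "w \<in> D" for z w
      unfolding F_def grad_def
      by (rule lipschitz_gradient_bounds[OF f(1,2) conv(1) DF diffD lipD that])+
    show "is_scalar_product (\<lambda>u v. s k * ip k u v)" for k
      by (rule scalar_product_scale[OF sp s_pos])
    show "s k * nu_seq k * (norm z)\<^sup>2 \<le> s k * ip k z z" for k z
      using form(3) s_pos[of k] by (simp add: mult.assoc)
    show "s0 * \<nu> \<le> s k * nu_seq k" for k
      using s form(1) bounds(1) s_pos[of k] by (intro mult_mono) auto
    show "s k * ip k z z \<le> s1 * \<mu> * (norm z)\<^sup>2" for k z
      unfolding mult.assoc using s(3) up scalar_product_nonneg[OF sp] s1 by (intro mult_mono) auto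
    show "s0 * c0 \<le> s k * \<gamma> k" for k
      using s c0 s_pos[of k] by (intro mult_mono) auto
    show "s k * \<gamma> k \<le> s1 * (c * \<mu> / l0)" for k
      using s(3) \<gamma>_le \<gamma>_pos[of k] s1 by (intro mult_mono) auto
    show "s k * \<gamma> k * lam k \<le> c * (s k * nu_seq k)" for k
      using mult_left_mono[OF c'[of k] less_imp_le[OF s_pos[of k]]] by (simp add: mult_ac)
    show "s k * ip k (z - y k) (x k - y k) \<le> s k * \<gamma> k * (G z - G (y k) + inner (z - y k) (grad (x k)))"
      if "z \<in> D" for k z
      unfolding mult.assoc G_def
      by (intro mult_left_mono less_imp_le[OF s_pos]
          prox_step(2)[OF sp bounds(1) low up g \<gamma>_pos y[rule_format] grad[OF x_D]]
          that[unfolded D_def])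
  qed (use s s1 \<mu> bounds(1) c0 l0 lam c lip x_D y_D x in auto)
  let ?\<Phi> = "\<lambda>z. f z + g z"
  have \<Phi>: "?\<Phi> z = ereal (it.obj z)" if "z \<in> D" for z
    using fg[OF that] by (simp add: it.obj_def)
  have \<Phi>x: "?\<Phi> (x k) = ereal (it.obj (x k))" and \<Phi>y: "?\<Phi> (y k) = ereal (it.obj (y k))" for k
    using \<Phi> x_D y_D by auto
  have minimal: "p \<in> S \<longleftrightarrow> it.minimal p" for p
  proof -
    have "p \<in> S \<longleftrightarrow> (\<forall>w. ?\<Phi> p \<le> ?\<Phi> w)"
      by (simp add: S argmin_set_def is_arg_min_def not_less)
    also have "\<dots> \<longleftrightarrow> it.minimal p"
    proof
      assume le: "\<forall>w. ?\<Phi> p \<le> ?\<Phi> w"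
      have p: "p \<in> D"
      proof (rule ccontr)
        assume "p \<notin> D"
        show False
          using le[rule_format, of "x 0"] unfolding fg_top[OF \<open>p \<notin> D\<close>] \<Phi>x by simp
      qed
      have "it.obj p \<le> it.obj w" if "w \<in> D" for w
        using le[rule_format, of w] unfolding \<Phi>[OF p] \<Phi>[OF that] by simp
      then show "it.minimal p"
        using p by (simp add: it.minimal_def)
    next
      assume "it.minimal p"
      then have p: "p \<in> D" "\<And>w. w \<in> D \<Longrightarrow> it.obj p \<le> it.obj w"
        by (auto simp: it.minimal_def)
      show "\<forall>w. ?\<Phi> p \<le> ?\<Phi> w"
      proof
        fix w
        show "?\<Phi> p \<le> ?\<Phi> w"
        proof (cases "w \<in> D")
          case True
          show ?thesis unfolding \<Phi>[OF p(1)] \<Phi>[OF True] using p(2)[OF True] by simp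
        next
          case False
          show ?thesis unfolding fg_top[OF False] by simp
        qed
      qed
    qed
    finally show ?thesis .
  qed
  have "decseq (\<lambda>k. ?\<Phi> (x k))"
    unfolding \<Phi>x using it.decseq_obj by (simp add: decseq_def)
  moreover have "summable (\<lambda>k. (norm (x (Suc k) - x k))\<^sup>2)" if bdd: "(INF k. ?\<Phi> (x k)) > -\<infinity>"
  proof -
    have "(INF k. ?\<Phi> (x k)) \<le> ereal (it.obj (x 0))"
      unfolding \<Phi>x by (rule INF_lower) simp
    then obtain m where m: "(INF k. ?\<Phi> (x k)) = ereal m"
      using bdd by (cases "INF k. ?\<Phi> (x k)") auto
    have "ereal m \<le> ereal (it.obj (x k))" for k
      unfolding m[symmetric] unfolding \<Phi>x by (rule INF_lower) simp
    then have "m \<le> it.obj (x k)" for k by simp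
    then have "summable (\<lambda>k. (norm (it.d k))\<^sup>2)" by (rule it.summable_steps)
    then show ?thesis
    proof (rule summable_comparison_test'[where N = 0])
      fix k
      have "norm (x (Suc k) - x k) = lam k * norm (it.d k)"
        using lam(1)[of k] x by (simp add: it.d_def)
      also have "\<dots> \<le> norm (it.d k)"
        using lam[of k] by (simp add: mult_left_le_one_le)
      finally show "norm ((norm (x (Suc k) - x k))\<^sup>2) \<le> (norm (it.d k))\<^sup>2"
        by (simp add: power_mono)
    qed
  qed
  moreover have "(\<exists>p\<in>S. weakly_converges x p \<and> weakly_converges y p)
        \<and> (\<lambda>k. ?\<Phi> (y k)) \<longlonglongrightarrow> (INF z. ?\<Phi> z)
        \<and> (\<lambda>k. ?\<Phi> (x k)) \<longlonglongrightarrow> (INF z. ?\<Phi> z)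
        \<and> (\<lambda>k. real_of_ereal (?\<Phi> (x k) - (INF z. ?\<Phi> z))) \<in> o(\<lambda>k. 1 / real k)"
    if ne: "S \<noteq> {}"
  proof -
    from ne obtain p where "p \<in> S" by blast
    then have p: "it.minimal p" by (simp only: minimal)
    then have "p \<in> D" by (simp add: it.minimal_def)
    have inf: "(INF z. ?\<Phi> z) = ereal (it.obj p)"
    proof (rule antisym)
      show "(INF z. ?\<Phi> z) \<le> ereal (it.obj p)"
        unfolding \<Phi>[OF \<open>p \<in> D\<close>, symmetric] by (rule INF_lower) simp
      have "\<forall>w. ?\<Phi> p \<le> ?\<Phi> w"
        using \<open>p \<in> S\<close> by (simp add: S argmin_set_def is_arg_min_def not_less)
      then show "ereal (it.obj p) \<le> (INF z. ?\<Phi> z)"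
        unfolding \<Phi>[OF \<open>p \<in> D\<close>, symmetric] by (intro INF_greatest) blast
    qed
    have "\<exists>p\<in>S. weakly_converges x p \<and> weakly_converges y p"
      using it.x_weakly_converges[OF p] it.y_weakly_converges[OF p] minimal by blast
    moreover have "(\<lambda>k. ?\<Phi> (y k)) \<longlonglongrightarrow> (INF z. ?\<Phi> z)" "(\<lambda>k. ?\<Phi> (x k)) \<longlonglongrightarrow> (INF z. ?\<Phi> z)"
      unfolding inf \<Phi>x \<Phi>y using it.obj_x_tendsto[OF p] it.obj_y_tendsto[OF p] by simp_all
    moreover have "(\<lambda>k. real_of_ereal (?\<Phi> (x k) - (INF z. ?\<Phi> z))) \<in> o(\<lambda>k. 1 / real k)"
      unfolding inf \<Phi>x using it.obj_rate[OF p] by simp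
    ultimately show ?thesis by blast
  qed
  moreover have "filterlim (\<lambda>k. norm (x k)) at_top sequentially
        \<and> (\<lambda>k. ?\<Phi> (x k)) \<longlonglongrightarrow> (INF z. ?\<Phi> z)" if "S = {}"
  proof
    have "\<nexists>p. it.minimal p" using that minimal by blast
    then show "filterlim (\<lambda>k. norm (x k)) at_top sequentially"
      by (rule it.norm_tendsto_infinity)
    \<comment> \<open>The infimum may be negative infinity here, so the iterates are compared with
      each point \<open>z\<close> separately, up to a slack \<open>e\<close>.\<close>
    have "(INF k. ?\<Phi> (x k)) = (INF z. ?\<Phi> z)"
    proof (rule antisym)
      show "(INF z. ?\<Phi> z) \<le> (INF k. ?\<Phi> (x k))"
        by (intro INF_greatest INF_lower) simp
      show "(INF k. ?\<Phi> (x k)) \<le> (INF z. ?\<Phi> z)"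
      proof (rule INF_greatest)
        fix z
        show "(INF k. ?\<Phi> (x k)) \<le> ?\<Phi> z"
        proof (cases "z \<in> D")
          case zD: True
          show ?thesis
          proof (rule ereal_le_epsilon2)
            fix e :: real assume "0 < e"
            then obtain k where k: "it.obj (x k) < it.obj z + e"
              using it.obj_near_infimum[OF zD] by blast
            have "(INF k. ?\<Phi> (x k)) \<le> ?\<Phi> (x k)" by (rule INF_lower) simp
            also have "\<dots> \<le> ?\<Phi> z + ereal e"
              unfolding \<Phi>x \<Phi>[OF zD] using k by simp
            finally show "(INF k. ?\<Phi> (x k)) \<le> ?\<Phi> z + ereal e" .
          qed
        qed (simp add: fg_top)
      qed
    qed
    moreover have "(\<lambda>k. ?\<Phi> (x k)) \<longlonglongrightarrow> (INF k. ?\<Phi> (x k))"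
      unfolding \<Phi>x using it.decseq_obj by (intro LIMSEQ_INF) (simp add: decseq_def)
    ultimately show "(\<lambda>k. ?\<Phi> (x k)) \<longlonglongrightarrow> (INF z. ?\<Phi> z)" by simp
  qed
  ultimately show ?thesis by blast
qed

end
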